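(* Let $\mathbb{F}$ be a countable field with the discrete topology, let $r>0$ be an integer, and let $K_r$ be the (Pontryagin) dual of the discrete group $\mathbb{F}^r$. Then: (1) the center of $\mathrm{Aut}_{\mathbb{F}}(K_r)$ has DCC on $K_r$; (2) if $\Gamma$ is a finitely generated abelian subgroup of $\mathrm{Aut}_{\mathbb{F}}(K_r)$ such that $\Gamma$ is ergodic on $K_r$, then $\Gamma$ contains an automorphism that is ergodic on $K_r$.
   Context: For an automorphism $\alpha$ of the discrete abelian group $A=\mathbb{F}^r$, its dual automorphism on $\hat A$ is $\chi\mapsto\chi\circ\alpha^{-1}$. $\mathrm{Aut}_{\mathbb{F}}(\mathbb{F}^r)$ is the group of all invertible $\mathbb{F}$-linear transformations of $\mathbb{F}^r$, and $\mathrm{Aut}_{\mathbb{F}}(K_r)$ is the corresponding group of dual automorphisms of the compact abelian group $K_r$. Let $K$ be a compact group with normalized Haar measure $\omega_K$. A group $\Gamma$ of continuous automorphisms of $K$ is ergodic on $K$ if every $\Gamma$-invariant Borel set $A\subset K$ satisfies $\omega_K(A)\in\{0,1\}$; an automorphism $\alpha$ is ergodic on $K$ if $\{\alpha^n\mid n\in\mathbb{Z}\}$ is. A group $H$ of automorphisms of $K$ has DCC on $K$ if for every decreasing sequence $(L_i)_{i\ge1}$ of $H$-invariant closed subgroups of $K$ there is $n\ge1$ with $L_n=L_{n+i}$ for all $i\ge0$. *)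

theory Defs
  imports "HOL-Analysis.Analysis" "HOL-Algebra.Algebra"
begin

definition group_center :: "('a, 'b) monoid_scheme \<Rightarrow> 'a set" where
  "group_center G = {z \<in> carrier G. \<forall>g \<in> carrier G. z \<otimes>\<^bsub>G\<^esub> g = g \<otimes>\<^bsub>G\<^esub> z}"

definition finitely_generated_subgroup :: "'a set \<Rightarrow> ('a, 'b) monoid_scheme \<Rightarrow> bool" where
  "finitely_generated_subgroup H G \<longleftrightarrow>
     (\<exists>S. finite S \<and> S \<subseteq> carrier G \<and> H = generate G S)"

text \<open>
  A compact group is given by a group \<open>K\<close> together with a topology \<open>T\<close> on its carrier.
  Groups of automorphisms of \<open>K\<close> are subgroups of \<^term>\<open>AutoGroup K\<close>, so their elements
  are functions that are \<^term>\<open>undefined\<close> outside of the carrier.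
\<close>

definition borel_of_topology :: "'a topology \<Rightarrow> 'a measure" where
  "borel_of_topology T = sigma (topspace T) {U. openin T U}"

text \<open>
  On a compact Hausdorff group, a translation-invariant, regular Borel probability measure
  exists and is unique. For a finite Borel measure on such a space, outer regularity
  is the same as regularity.
\<close>

definition normalized_haar_measure ::
    "('a, 'b) monoid_scheme \<Rightarrow> 'a topology \<Rightarrow> 'a measure \<Rightarrow> bool" where
  "normalized_haar_measure K T \<omega> \<longleftrightarrow>
     space \<omega> = topspace T \<and>
     sets \<omega> = sets (borel_of_topology T) \<and>
     emeasure \<omega> (space \<omega>) = 1 \<and>
     (\<forall>g \<in> carrier K. \<forall>A \<in> sets \<omega>. emeasure \<omega> ((\<lambda>x. g \<otimes>\<^bsub>K\<^esub> x) ` A) = emeasure \<omega> A) \<and>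
     (\<forall>A \<in> sets \<omega>. emeasure \<omega> A = (INF U \<in> {U. openin T U \<and> A \<subseteq> U}. emeasure \<omega> U))"

text \<open>
  Below, \<open>\<Gamma>\<close> is a group of automorphisms, so invariance of \<open>A\<close> under \<open>\<Gamma>\<close> may be written
  with equality instead of inclusion.
\<close>

definition invariant_under :: "('a \<Rightarrow> 'a) set \<Rightarrow> 'a set \<Rightarrow> bool" where
  "invariant_under \<Gamma> A \<longleftrightarrow> (\<forall>\<gamma> \<in> \<Gamma>. \<gamma> ` A = A)"

definition ergodic_group :: "'a measure \<Rightarrow> ('a \<Rightarrow> 'a) set \<Rightarrow> bool" where
  "ergodic_group \<omega> \<Gamma> \<longleftrightarrow>
     (\<forall>A \<in> sets \<omega>. invariant_under \<Gamma> A \<longrightarrow> emeasure \<omega> A \<in> {0, 1})"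

definition ergodic_automorphism ::
    "('a, 'b) monoid_scheme \<Rightarrow> 'a measure \<Rightarrow> ('a \<Rightarrow> 'a) \<Rightarrow> bool" where
  "ergodic_automorphism K \<omega> \<alpha> \<longleftrightarrow>
     ergodic_group \<omega> {\<alpha> [^]\<^bsub>AutoGroup K\<^esub> n | n :: int. True}"

definition has_DCC ::
    "('a, 'b) monoid_scheme \<Rightarrow> 'a topology \<Rightarrow> ('a \<Rightarrow> 'a) set \<Rightarrow> bool" where
  "has_DCC K T H \<longleftrightarrow>
     (\<forall>L :: nat \<Rightarrow> 'a set.
        decseq L \<and> (\<forall>i. subgroup (L i) K \<and> closedin T (L i) \<and> invariant_under H (L i))
        \<longrightarrow> (\<exists>n. \<forall>i. L n = L (n + i)))"

text \<open>
  All characters of a discrete group are continuous, and its compact subsets are the finite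
  ones, so that the compact-open topology on the dual is that of pointwise convergence.
\<close>

definition dual_group :: "('a :: ab_group_add \<Rightarrow> complex) monoid" where
  "dual_group =
     \<lparr>carrier = {\<xi>. (\<forall>x. cmod (\<xi> x) = 1) \<and> (\<forall>x y. \<xi> (x + y) = \<xi> x * \<xi> y)},
      mult = (\<lambda>\<xi> \<psi> x. \<xi> x * \<psi> x),
      one = (\<lambda>x. 1)\<rparr>"

definition dual_topology :: "('a :: ab_group_add \<Rightarrow> complex) topology" where
  "dual_topology =
     subtopology (product_topology (\<lambda>_. euclidean) UNIV) (carrier dual_group)"

definition dual_automorphism ::
    "('a :: ab_group_add \<Rightarrow> 'a) \<Rightarrow> ('a \<Rightarrow> complex) \<Rightarrow> ('a \<Rightarrow> complex)" where
  "dual_automorphism \<alpha> = (\<lambda>\<xi> \<in> carrier dual_group. \<xi> \<circ> inv_into UNIV \<alpha>)"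

definition linear_automorphisms :: "('f :: field ^ 'n \<Rightarrow> 'f ^ 'n) set" where
  "linear_automorphisms = {\<alpha>. Vector_Spaces.linear (*s) (*s) \<alpha> \<and> bij \<alpha>}"

definition dual_linear_automorphism_group ::
    "(('f :: field ^ 'n \<Rightarrow> complex) \<Rightarrow> ('f ^ 'n \<Rightarrow> complex)) monoid" where
  "dual_linear_automorphism_group =
     (AutoGroup dual_group)\<lparr>carrier := dual_automorphism ` linear_automorphisms\<rparr>"

end

theory Submission
  imports Defs "HOL-Probability.Probability_Measure"
begin

text \<open>
  Closed subgroups of the dual group correspond to their annihilators in \<open>F\<^sup>r\<close>. The scalars are
  central, so the annihilator of a subgroup that is invariant under the center is a linear subspace,
  and a descending chain of closed subgroups becomes stationary for reasons of dimension.

  If some nonzero vector has a finite \<open>\<Gamma>\<close>-orbit, then the characters close to \<open>1\<close> on this orbit form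
  arbitrarily small invariant neighbourhoods of \<open>1\<close>, and \<open>\<Gamma>\<close> is not ergodic. Conversely, an
  automorphism without nonzero periodic vectors is mixing on trigonometric polynomials, hence
  ergodic. It remains to find such an automorphism in \<open>\<Gamma>\<close>. Call a vector quasi-periodic if it lies
  in the largest subspace on which a power of the automorphism is unipotent. For commuting \<open>\<alpha>\<close> and
  \<open>\<beta>\<close> the spaces of quasi-periodic vectors of \<open>\<alpha>\<^sup>m \<beta>\<close> are independent modulo the vectors that are
  quasi-periodic for both \<open>\<alpha>\<close> and \<open>\<beta>\<close>, so some \<open>\<alpha>\<^sup>m \<beta>\<close> has no other quasi-periodic vectors. Applied
  to the generators one by one, this gives an element of \<open>\<Gamma>\<close> whose quasi-periodic vectors are
  quasi-periodic for all generators, and if there was a nonzero one, then there would also be a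
  nonzero vector that is periodic for all generators and has a finite orbit.
\<close>

section \<open>Quasi-periodic vectors\<close>

text \<open>The Haar measure is known through its axioms alone, as an outer regular
  translation-invariant Borel probability measure. Fourier analysis therefore runs on real
  trigonometric polynomials: translation invariance determines their integrals, and
  Stone-Weierstrass together with regularity makes them dense in L1. Uniqueness of Haar measure
  results from this, and uniqueness shows that automorphisms preserve the measure, which the mixing
  argument requires.

  Periodic vectors alone would not carry the independence argument. It applies a map
  \<open>h^k - 1\<close> and has to conclude from the image of a vector that the vector itself is
  exceptional for h. For a unipotent 2 by 2 Jordan block over the rationals this fails: only
  multiples of the eigenvector are periodic, yet \<open>h - 1\<close> sends every vector to such a
  multiple.

  Separation of points by characters is settled by a dichotomy: either all characters are trivial
  and the dual is a single point, or one nontrivial character can be pulled back so as to be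
  nontrivial at any given nonzero vector.\<close>

lemma additive_funpow:
  fixes f :: "'a :: ab_group_add \<Rightarrow> 'a"
  shows "Modules.additive f \<Longrightarrow> Modules.additive (f ^^ n)"
  by (induction n) (simp_all add: Modules.additive_def)

lemma funpow_commute:
  assumes "f \<circ> g = g \<circ> f"
  shows "(f ^^ m) ((g ^^ n) x) = (g ^^ n) ((f ^^ m) x)"
proof -
  have 1: "(f ^^ m) (g y) = g ((f ^^ m) y)" for y
    using assms by (induction m arbitrary: y) (auto simp: fun_eq_iff)
  show ?thesis
    by (induction n) (auto simp: 1)
qed

lemma comp_funpow_commute: "f \<circ> g = g \<circ> f \<Longrightarrow> f \<circ> g ^^ n = g ^^ n \<circ> f"
  using funpow_commute[of f g 1 n] by (auto simp: fun_eq_iff)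

lemma funpow_comp:
  assumes "f \<circ> g = g \<circ> f"
  shows "(f \<circ> g) ^^ n = (f ^^ n) \<circ> (g ^^ n)"
proof (induction n)
  case (Suc n)
  have "g ((f ^^ n) y) = (f ^^ n) (g y)" for y
    using funpow_commute[OF assms, of n 1 y] by simp
  with Suc show ?case by (auto simp: fun_eq_iff)
qed auto

text \<open>
  The vectors on which a power of \<open>\<alpha>\<close> acts unipotently. Unlike the periodic vectors, they have the
  property that \<open>\<alpha>\<close> has no periodic vectors in the quotient by them.
\<close>

inductive_set quasi_periodic :: "('a :: ab_group_add \<Rightarrow> 'a) \<Rightarrow> 'a set" for \<alpha> where
  zero: "0 \<in> quasi_periodic \<alpha>"
| step: "k > 0 \<Longrightarrow> (\<alpha> ^^ k) v - v \<in> quasi_periodic \<alpha> \<Longrightarrow> v \<in> quasi_periodic \<alpha>"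

text \<open>A commuting additive map carries the chain of differences that witnesses
  quasi-periodicity of v to one for its image. Taking negation, \<open>\<beta> - 1\<close> or a
  scaling as this map yields most closure properties below.\<close>

lemma quasi_periodic_image:
  assumes "Modules.additive \<beta>" "\<alpha> \<circ> \<beta> = \<beta> \<circ> \<alpha>" "v \<in> quasi_periodic \<alpha>"
  shows "\<beta> v \<in> quasi_periodic \<alpha>"
  using assms(3)
proof induction
  case zero
  then show ?case using additive.zero[OF assms(1)] by (simp add: quasi_periodic.zero)
next
  case (step k v)
  have "(\<alpha> ^^ k) (\<beta> v) = \<beta> ((\<alpha> ^^ k) v)"
    using funpow_commute[OF assms(2), of k 1] by simp
  with step show ?case
    by (auto simp: additive.diff[OF assms(1)] intro: quasi_periodic.step)
qed

lemma quasi_periodic_uminus: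
  assumes "Modules.additive \<alpha>" "v \<in> quasi_periodic \<alpha>"
  shows "- v \<in> quasi_periodic \<alpha>"
  using quasi_periodic_image[of uminus \<alpha> v] assms
  by (auto simp: Modules.additive_def fun_eq_iff additive.minus)

lemma additive_diff_id: "Modules.additive \<beta> \<Longrightarrow> Modules.additive (\<lambda>v. \<beta> v - v)"
  by (auto simp: Modules.additive_def algebra_simps)

lemma quasi_periodic_diff_image:
  assumes "Modules.additive \<alpha>" "Modules.additive \<beta>" "\<alpha> \<circ> \<beta> = \<beta> \<circ> \<alpha>" "v \<in> quasi_periodic \<alpha>"
  shows "\<beta> v - v \<in> quasi_periodic \<alpha>"
proof -
  have "\<alpha> \<circ> (\<lambda>v. \<beta> v - v) = (\<lambda>v. \<beta> v - v) \<circ> \<alpha>"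
    using assms(3) by (auto simp: fun_eq_iff additive.diff[OF assms(1)])
  then show ?thesis
    using quasi_periodic_image[OF additive_diff_id[OF assms(2)]] assms(4) by blast
qed

text \<open>Induction on the derivation for v alone, with w arbitrary: passing to
  \<open>\<alpha>^k v - v\<close> replaces w by \<open>\<alpha>^k w - w\<close>, which need not be
  simpler but is still quasi-periodic.\<close>

lemma quasi_periodic_add:
  assumes "Modules.additive \<alpha>" "v \<in> quasi_periodic \<alpha>" "w \<in> quasi_periodic \<alpha>"
  shows "v + w \<in> quasi_periodic \<alpha>"
  using assms(2,3)
proof (induction arbitrary: w)
  case (step k v)
  have "(\<alpha> ^^ k) w - w \<in> quasi_periodic \<alpha>"
    by (rule quasi_periodic_diff_image[OF assms(1) additive_funpow[OF assms(1)]
          comp_funpow_commute[OF refl] step.prems])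
  then have "((\<alpha> ^^ k) v - v) + ((\<alpha> ^^ k) w - w) \<in> quasi_periodic \<alpha>"
    by (rule step.IH)
  then have "(\<alpha> ^^ k) (v + w) - (v + w) \<in> quasi_periodic \<alpha>"
    by (simp add: additive.add[OF additive_funpow[OF assms(1)]] algebra_simps)
  then show ?case by (rule quasi_periodic.step[OF step.hyps(1)])
qed auto

lemma quasi_periodic_diff:
  assumes "Modules.additive \<alpha>" "v \<in> quasi_periodic \<alpha>" "w \<in> quasi_periodic \<alpha>"
  shows "v - w \<in> quasi_periodic \<alpha>"
  using quasi_periodic_add[OF assms(1,2) quasi_periodic_uminus[OF assms(1,3)]] by simp

lemma quasi_periodic_diff_funpow:
  assumes "Modules.additive \<alpha>" "Modules.additive \<beta>" "\<alpha> \<circ> \<beta> = \<beta> \<circ> \<alpha>" "\<beta> v - v \<in> quasi_periodic \<alpha>"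
  shows "(\<beta> ^^ j) v - v \<in> quasi_periodic \<alpha>"
proof (induction j)
  case (Suc j)
  have "\<beta> ((\<beta> ^^ j) v - v) + (\<beta> v - v) \<in> quasi_periodic \<alpha>"
    by (rule quasi_periodic_add[OF assms(1) quasi_periodic_image[OF assms(2,3) Suc] assms(4)])
  then show ?case by (simp add: additive.diff[OF assms(2)])
qed (auto intro: quasi_periodic.zero)

text \<open>Exponents can be enlarged: if \<open>\<alpha>^l\<close> fixes v modulo an invariant
  group, so does \<open>\<alpha>^(l k)\<close>, which is the l-th power of
  \<open>\<alpha>^k\<close>.\<close>

lemma quasi_periodic_funpow:
  assumes "Modules.additive \<alpha>" "k > 0"
  shows "quasi_periodic (\<alpha> ^^ k) = quasi_periodic \<alpha>"
proof
  show "quasi_periodic (\<alpha> ^^ k) \<subseteq> quasi_periodic \<alpha>"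
  proof
    fix v assume "v \<in> quasi_periodic (\<alpha> ^^ k)"
    then show "v \<in> quasi_periodic \<alpha>"
    proof induction
      case (step l v)
      then show ?case
        using quasi_periodic.step[of "k * l"] assms(2) by (simp add: funpow_mult mult.commute)
    qed (rule quasi_periodic.zero)
  qed
  show "quasi_periodic \<alpha> \<subseteq> quasi_periodic (\<alpha> ^^ k)"
  proof
    fix v assume "v \<in> quasi_periodic \<alpha>"
    then show "v \<in> quasi_periodic (\<alpha> ^^ k)"
    proof induction
      case (step l v)
      have "((\<alpha> ^^ l) ^^ k) v - v \<in> quasi_periodic (\<alpha> ^^ k)"
        by (rule quasi_periodic_diff_funpow[OF additive_funpow[OF assms(1)] additive_funpow[OF assms(1)]
              _ step.IH]) (metis comp_funpow_commute)
      then have "((\<alpha> ^^ k) ^^ l) v - v \<in> quasi_periodic (\<alpha> ^^ k)"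
        by (simp add: funpow_mult mult.commute)
      then show ?case by (rule quasi_periodic.step[OF step.hyps(1)])
    qed (rule quasi_periodic.zero)
  qed
qed

text \<open>For n = k l, a common multiple of the two exponents, \<open>(\<alpha> \<beta>)^n - 1 =
  \<alpha>^n (\<beta>^n - 1) + (\<alpha>^n - 1)\<close>. Both terms have to be controlled at once,
  so the induction for \<beta> is nested in the one for \<alpha>.\<close>

lemma quasi_periodic_comp:
  assumes "Modules.additive \<alpha>" "Modules.additive \<beta>" "\<alpha> \<circ> \<beta> = \<beta> \<circ> \<alpha>"
    and "v \<in> quasi_periodic \<alpha>" "v \<in> quasi_periodic \<beta>"
  shows "v \<in> quasi_periodic (\<alpha> \<circ> \<beta>)"
  using assms(4,5)
proof (induction v)
  case (step k v)
  let ?Q = "quasi_periodic (\<alpha> \<circ> \<beta>)"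
  have add: "Modules.additive (\<alpha> \<circ> \<beta>)"
    using assms(1,2) by (auto simp: Modules.additive_def)
  have comm: "(\<alpha> \<circ> \<beta>) \<circ> \<alpha> = \<alpha> \<circ> (\<alpha> \<circ> \<beta>)" "(\<alpha> \<circ> \<beta>) \<circ> \<beta> = \<beta> \<circ> (\<alpha> \<circ> \<beta>)"
    using assms(3) by (auto simp: fun_eq_iff)
  note comm_pow = comp_funpow_commute
  \<comment> \<open>The outer induction hypothesis applies, as this difference is still
    quasi-periodic for \<beta>. The result becomes a premise of the inner induction, in which k
    stays fixed.\<close>
  have "(\<alpha> ^^ k) v - v \<in> ?Q"
    by (intro step.IH quasi_periodic_diff_image[OF assms(2) additive_funpow[OF assms(1)]]
        comm_pow assms(3)[symmetric] step.prems)
  from step.prems this show ?case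
  proof (induction v)
    case (step l v)
    define u where "u = (\<beta> ^^ l) v - v"
    \<comment> \<open>Descending from v to u requires the premise for u; commutation moves
      \<open>\<alpha>^k - 1\<close> past \<open>\<beta>^l - 1\<close>.\<close>
    have "(\<alpha> ^^ k) u - u = (\<beta> ^^ l) ((\<alpha> ^^ k) v - v) - ((\<alpha> ^^ k) v - v)"
      unfolding u_def additive.diff[OF additive_funpow[OF assms(1)]]
        additive.diff[OF additive_funpow[OF assms(2)]] funpow_commute[OF assms(3)]
      by simp
    also have "\<dots> \<in> ?Q"
      by (intro quasi_periodic_diff_image[OF add additive_funpow[OF assms(2)]] comm_pow comm step.prems)
    finally have u: "u \<in> ?Q"
      unfolding u_def by (rule step.IH)
    have "((\<beta> ^^ l) ^^ k) v - v \<in> ?Q"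
      using u unfolding u_def
      by (intro quasi_periodic_diff_funpow[OF add additive_funpow[OF assms(2)]] comm_pow comm)
    then have "((\<alpha> ^^ k) ^^ l) (((\<beta> ^^ l) ^^ k) v - v) \<in> ?Q"
      by (intro quasi_periodic_image[OF additive_funpow[OF additive_funpow[OF assms(1)]]] comm_pow comm)
    moreover have "((\<alpha> ^^ k) ^^ l) v - v \<in> ?Q"
      by (intro quasi_periodic_diff_funpow[OF add additive_funpow[OF assms(1)]] comm_pow comm step.prems)
    ultimately have "((\<alpha> ^^ k) ^^ l) (((\<beta> ^^ l) ^^ k) v - v) + (((\<alpha> ^^ k) ^^ l) v - v) \<in> ?Q"
      by (rule quasi_periodic_add[OF add])
    moreover have "((\<alpha> ^^ k) ^^ l) (((\<beta> ^^ l) ^^ k) v - v) + (((\<alpha> ^^ k) ^^ l) v - v)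
        = ((\<alpha> \<circ> \<beta>) ^^ (k * l)) v - v"
      unfolding additive.diff[OF additive_funpow[OF additive_funpow[OF assms(1)]]]
        funpow_comp[OF assms(3)]
      by (simp add: funpow_mult mult.commute)
    ultimately have "((\<alpha> \<circ> \<beta>) ^^ (k * l)) v - v \<in> ?Q"
      by (simp only:)
    moreover have "k * l > 0"
      using \<open>k > 0\<close> \<open>l > 0\<close> by simp
    ultimately show ?case by (rule quasi_periodic.step[rotated])
  qed (rule quasi_periodic.zero)
qed (rule quasi_periodic.zero)

text \<open>The difference \<open>\<beta>^k v - v\<close> is \<open>\<beta>^k\<close> applied to the
  negative of \<open>\<alpha>^k v - v\<close>.\<close>

lemma quasi_periodic_inverse:
  assumes "Modules.additive \<alpha>" "Modules.additive \<beta>" "\<And>v. \<beta> (\<alpha> v) = v" "v \<in> quasi_periodic \<alpha>" "\<And>v. \<alpha> (\<beta> v) = v"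
  shows "v \<in> quasi_periodic \<beta>"
  using assms(4)
proof induction
  case (step k v)
  have inv: "(\<beta> ^^ k) ((\<alpha> ^^ k) v) = v"
    using funpow_comp[of \<beta> \<alpha> k] assms(3,5) by (simp add: fun_eq_iff comp_def id_def[symmetric])
  have "(\<beta> ^^ k) (- ((\<alpha> ^^ k) v - v)) \<in> quasi_periodic \<beta>"
    by (intro quasi_periodic_image[OF additive_funpow[OF assms(2)] comp_funpow_commute[OF refl]]
        quasi_periodic_uminus[OF assms(2)] step.IH)
  then have "(\<beta> ^^ k) v - v \<in> quasi_periodic \<beta>"
    by (simp add: additive.diff[OF additive_funpow[OF assms(2)]]
        additive.minus[OF additive_funpow[OF assms(2)]] inv)
  then show ?case by (rule quasi_periodic.step[OF step.hyps(1)])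
qed (rule quasi_periodic.zero)

lemma quasi_periodic_cancel:
  assumes "Modules.additive \<alpha>" "Modules.additive \<beta>" "bij \<beta>" "\<alpha> \<circ> \<beta> = \<beta> \<circ> \<alpha>"
    and "v \<in> quasi_periodic (\<alpha> \<circ> \<beta>)" "v \<in> quasi_periodic \<beta>"
  shows "v \<in> quasi_periodic \<alpha>"
proof -
  define \<beta>' where "\<beta>' = inv_into UNIV \<beta>"
  have inv: "\<beta> (\<beta>' w) = w" "\<beta>' (\<beta> w) = w" for w
    using assms(3) by (auto simp: \<beta>'_def bij_is_inj bij_is_surj surj_f_inv_f)
  have add: "Modules.additive \<beta>'"
    unfolding Modules.additive_def by (metis additive.add[OF assms(2)] inv)
  have add': "Modules.additive (\<alpha> \<circ> \<beta>)"
    using assms(1,2) by (auto simp: Modules.additive_def)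
  have "(\<alpha> \<circ> \<beta>) \<circ> \<beta>' = \<beta>' \<circ> (\<alpha> \<circ> \<beta>)"
    using assms(4) by (auto simp: fun_eq_iff inv)
  moreover have "v \<in> quasi_periodic \<beta>'"
    by (rule quasi_periodic_inverse[OF assms(2) add inv(2) assms(6) inv(1)])
  ultimately have "v \<in> quasi_periodic ((\<alpha> \<circ> \<beta>) \<circ> \<beta>')"
    by (intro quasi_periodic_comp[OF add' add] assms(5))
  then show ?thesis by (simp add: comp_def inv)
qed

text \<open>The analogue of the independence of eigenspaces for distinct eigenvalues. Instead of
  subtracting an eigenvalue, maps \<open>h j ^^ k - 1\<close> are applied until the summand
  belonging to \<open>h j\<close> has disappeared; Q takes the place of 0.\<close>

lemma quasi_periodic_independent:
  fixes h :: "'i \<Rightarrow> 'a :: ab_group_add \<Rightarrow> 'a"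
  assumes add: "\<And>i. Modules.additive (h i)"
    and comm: "\<And>i j. h i \<circ> h j = h j \<circ> h i"
    and Q: "0 \<in> Q" "\<And>v w. v \<in> Q \<Longrightarrow> w \<in> Q \<Longrightarrow> v - w \<in> Q"
      "\<And>i v. v \<in> Q \<Longrightarrow> h i v \<in> Q" "\<And>i. Q \<subseteq> quasi_periodic (h i)"
    and disj: "\<And>i j. i \<noteq> j \<Longrightarrow> quasi_periodic (h i) \<inter> quasi_periodic (h j) \<subseteq> Q"
    and "finite I" "\<And>i. i \<in> I \<Longrightarrow> u i \<in> quasi_periodic (h i)" "sum u I \<in> Q"
  shows "\<forall>i\<in>I. u i \<in> Q"
  using assms(8-)
proof (induction I arbitrary: u rule: finite_induct)
  case (insert j I)
  have Qsum: "v + w \<in> Q" if "v \<in> Q" "w \<in> Q" for v w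
    using Q(2)[OF that(1) Q(2)[OF Q(1) that(2)]] by simp
  have Qpow: "(h j ^^ k) v \<in> Q" if "v \<in> Q" for k v
    using that Q(3) by (induction k) auto
  \<comment> \<open>The j-th summand v is split off so that its derivation can be inducted on. The
    other summands are arbitrary, because each step replaces them by their images under
    \<open>h j ^^ k - 1\<close>.\<close>
  have main: "\<forall>i\<in>I. u i \<in> Q" if "v \<in> quasi_periodic (h j)"
    "\<And>i. i \<in> I \<Longrightarrow> u i \<in> quasi_periodic (h i)" "sum u I + v \<in> Q" for u v
    using that
  proof (induction v arbitrary: u)
    case zero
    show ?case
      by (rule insert.IH[OF zero.prems(1)]) (use zero.prems(2) in auto)
  next
    case (step k v)
    let ?T = "\<lambda>v. (h j ^^ k) v - v"
    have addT: "Modules.additive ?T"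
      by (intro additive_diff_id additive_funpow add)
    have "?T (sum u I + v) \<in> Q"
      by (intro Q(2) Qpow step.prems)
    then have "(\<Sum>i\<in>I. ?T (u i)) + ?T v \<in> Q"
      by (simp only: additive.add[OF addT] additive.sum[OF addT])
    moreover have T': "?T (u i) \<in> quasi_periodic (h i)" if "i \<in> I" for i
      by (rule quasi_periodic_diff_image[OF add additive_funpow[OF add] comp_funpow_commute[OF comm]
            step.prems(1)[OF that]])
    ultimately have T: "\<forall>i\<in>I. ?T (u i) \<in> Q"
      by (intro step.IH) auto
    show ?case
    proof
      fix i assume i: "i \<in> I"
      \<comment> \<open>Since Q lies in the quasi-periodic vectors of \<open>h j\<close>, the
        closure of these under the step rule lifts the information from \<open>?T (u i)\<close> back
        to \<open>u i\<close>; disjointness modulo Q then finishes.\<close>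
      have "?T (u i) \<in> quasi_periodic (h j)"
        using T i Q(4)[of j] by blast
      then have "u i \<in> quasi_periodic (h j)"
        by (rule quasi_periodic.step[OF step.hyps(1)])
      moreover have "i \<noteq> j" using i insert.hyps by auto
      ultimately show "u i \<in> Q"
        using step.prems(1)[OF i] disj[of i j] by blast
    qed
  qed
  have sum: "sum u I + u j \<in> Q"
    using insert.prems(2) insert.hyps by (simp add: add.commute)
  have I: "\<forall>i\<in>I. u i \<in> Q"
    by (rule main[OF _ _ sum]) (use insert.prems(1) in auto)
  then have "sum u I \<in> Q"
    using Q(1) Qsum by (induction I rule: infinite_finite_induct) auto
  then have "u j \<in> Q"
    using Q(2)[OF sum] by (metis add_diff_cancel_left')
  with I show ?case by auto
qed auto

section \<open>Linear automorphisms\<close>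

lemma linear_automorphism_additive:
  "\<alpha> \<in> linear_automorphisms \<Longrightarrow> Modules.additive \<alpha>"
  by (auto simp: linear_automorphisms_def Modules.additive_def vec.linear_add)

lemma linear_automorphism_scale:
  "\<alpha> \<in> linear_automorphisms \<Longrightarrow> \<alpha> (c *s v) = c *s \<alpha> v"
  by (auto simp: linear_automorphisms_def vec.linear_scale)

lemma linear_automorphism_comp:
  "\<alpha> \<in> linear_automorphisms \<Longrightarrow> \<beta> \<in> linear_automorphisms \<Longrightarrow> \<alpha> \<circ> \<beta> \<in> linear_automorphisms"
  by (auto simp: linear_automorphisms_def Vector_Spaces.linear_iff intro: bij_comp)

lemma linear_automorphism_inv:
  "\<alpha> \<in> linear_automorphisms \<Longrightarrow> inv_into UNIV \<alpha> \<in> linear_automorphisms"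
proof -
  assume \<alpha>: "\<alpha> \<in> linear_automorphisms"
  then have bij: "bij \<alpha>" and lin: "Vector_Spaces.linear (*s) (*s) \<alpha>"
    by (auto simp: linear_automorphisms_def)
  have inv: "\<alpha> (inv_into UNIV \<alpha> v) = v" "inv_into UNIV \<alpha> (\<alpha> v) = v" for v
    using bij by (auto simp: bij_is_inj bij_is_surj surj_f_inv_f)
  have "inv_into UNIV \<alpha> (x + y) = inv_into UNIV \<alpha> x + inv_into UNIV \<alpha> y" for x y
    by (metis inv vec.linear_add[OF lin])
  moreover have "inv_into UNIV \<alpha> (c *s x) = c *s inv_into UNIV \<alpha> x" for c x
    by (metis inv vec.linear_scale[OF lin])
  ultimately show ?thesis
    using bij_imp_bij_inv[OF bij] by (simp add: linear_automorphisms_def Vector_Spaces.linear_iff vec.vector_space_axioms)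
qed

lemma linear_automorphism_id: "id \<in> linear_automorphisms"
  by (auto simp: linear_automorphisms_def vec.linear_id)

lemma linear_automorphism_funpow:
  fixes \<alpha> :: "'f :: field ^ 'n \<Rightarrow> 'f ^ 'n"
  shows "\<alpha> \<in> linear_automorphisms \<Longrightarrow> \<alpha> ^^ n \<in> linear_automorphisms"
  by (induction n) (simp_all add: linear_automorphism_comp linear_automorphism_id)

text \<open>Makes the quasi-periodic vectors a linear subspace over the field, so that independence
  of such spaces can be played off against the dimension.\<close>

lemma quasi_periodic_scale:
  assumes "\<alpha> \<in> linear_automorphisms" "v \<in> quasi_periodic \<alpha>"
  shows "c *s v \<in> quasi_periodic \<alpha>"
proof (rule quasi_periodic_image[OF _ _ assms(2)])
  show "Modules.additive ((*s) c)"
    by (simp add: Modules.additive_def vec.scale_right_distrib)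
qed (auto simp: fun_eq_iff linear_automorphism_scale[OF assms(1)])

lemma ex_quasi_periodic_subset:
  fixes \<alpha> \<beta> :: "'f :: field ^ 'n \<Rightarrow> 'f ^ 'n"
  assumes \<alpha>: "\<alpha> \<in> linear_automorphisms" and \<beta>: "\<beta> \<in> linear_automorphisms"
    and comm: "\<alpha> \<circ> \<beta> = \<beta> \<circ> \<alpha>"
  shows "\<exists>m. quasi_periodic (\<alpha> ^^ m \<circ> \<beta>) \<subseteq> quasi_periodic \<alpha> \<inter> quasi_periodic \<beta>"
proof (rule ccontr)
  define Q where "Q = quasi_periodic \<alpha> \<inter> quasi_periodic \<beta>"
  define h where "h m = \<alpha> ^^ m \<circ> \<beta>" for m
  assume "\<nexists>m. quasi_periodic (\<alpha> ^^ m \<circ> \<beta>) \<subseteq> quasi_periodic \<alpha> \<inter> quasi_periodic \<beta>"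
  then have "\<exists>v. v \<in> quasi_periodic (h m) - Q" for m
    by (auto simp: h_def Q_def)
  then obtain u where u: "u m \<in> quasi_periodic (h m)" "u m \<notin> Q" for m
    by (metis DiffE)
  have lin: "h m \<in> linear_automorphisms" for m
    unfolding h_def by (intro linear_automorphism_comp linear_automorphism_funpow \<alpha> \<beta>)
  note add = linear_automorphism_additive[OF lin]
    and add_\<alpha> = linear_automorphism_additive[OF \<alpha>]
    and add_\<beta> = linear_automorphism_additive[OF \<beta>]
  have comm_\<beta>: "\<alpha> ^^ m \<circ> \<beta> = \<beta> \<circ> \<alpha> ^^ m" for m
    by (rule comp_funpow_commute[OF comm[symmetric], symmetric])
  have comm_h: "\<alpha> ^^ m \<circ> h k = h k \<circ> \<alpha> ^^ m" "\<beta> \<circ> h k = h k \<circ> \<beta>" for m k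
    using comm_\<beta> funpow_commute[of \<alpha> \<alpha> m k] by (auto simp: h_def fun_eq_iff)
  then have comm_hh: "h i \<circ> h j = h j \<circ> h i" for i j
    by (metis comp_assoc h_def)
  have bij: "bij (h m)" for m
    using lin by (auto simp: linear_automorphisms_def)
  have Q0: "0 \<in> Q" "\<And>v w. v \<in> Q \<Longrightarrow> w \<in> Q \<Longrightarrow> v - w \<in> Q"
    by (auto simp: Q_def quasi_periodic.zero quasi_periodic_diff add_\<alpha> add_\<beta>)
  have Qh: "h i v \<in> Q" if "v \<in> Q" for i v
    using that quasi_periodic_image[OF add, of \<alpha> i v] quasi_periodic_image[OF add, of \<beta> i v]
      comm_h(1)[of 1 i] comm_h(2)[of i] by (auto simp: Q_def)
  have Qs: "c *s v \<in> Q" if "v \<in> Q" for c v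
    using that by (auto simp: Q_def quasi_periodic_scale \<alpha> \<beta>)
  \<comment> \<open>For m = 0 the power is the identity, for which every vector is quasi-periodic.
    This case occurs because the family contains \<open>h 0\<close>.\<close>
  have pow: "v \<in> quasi_periodic (\<alpha> ^^ m)" if "v \<in> quasi_periodic \<alpha>" for m v
  proof (cases "m = 0")
    case True
    show ?thesis by (rule quasi_periodic.step[of 1]) (auto simp: True quasi_periodic.zero)
  qed (use that quasi_periodic_funpow[OF add_\<alpha>] in auto)
  have Qh': "Q \<subseteq> quasi_periodic (h m)" for m
    unfolding h_def Q_def
    by (intro subsetI quasi_periodic_comp additive_funpow add_\<alpha> add_\<beta> comm_\<beta> pow) auto
  have disj: "quasi_periodic (h i) \<inter> quasi_periodic (h j) \<subseteq> Q" if "i < j" for i j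
  proof
    fix v assume v: "v \<in> quasi_periodic (h i) \<inter> quasi_periodic (h j)"
    \<comment> \<open>Two members of the family differ by a power of \<alpha>. Cancelling
      \<open>h i\<close> from \<open>h j\<close> leaves \<open>\<alpha>^(j - i)\<close>, so v is
      quasi-periodic for \<alpha>; cancelling \<open>\<alpha>^i\<close> from \<open>h i\<close> then
      leaves \<beta>.\<close>
    have hj: "h j = \<alpha> ^^ (j - i) \<circ> h i"
      using that by (simp add: h_def comp_assoc[symmetric] funpow_add[symmetric])
    have "v \<in> quasi_periodic (\<alpha> ^^ (j - i))"
      by (rule quasi_periodic_cancel[OF additive_funpow[OF add_\<alpha>] add bij comm_h(1)])
        (use v hj in auto)
    then have v\<alpha>: "v \<in> quasi_periodic \<alpha>"
      using quasi_periodic_funpow[OF add_\<alpha>, of "j - i"] that by simp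
    have "bij (\<alpha> ^^ i)"
      using linear_automorphism_funpow[OF \<alpha>] by (auto simp: linear_automorphisms_def)
    moreover have "\<beta> \<circ> \<alpha> ^^ i = h i"
      by (simp add: h_def comm_\<beta>)
    ultimately have "v \<in> quasi_periodic \<beta>"
      using v pow[OF v\<alpha>, of i]
      by (intro quasi_periodic_cancel[OF add_\<beta> additive_funpow[OF add_\<alpha>] _ comm_\<beta>[symmetric]]) auto
    with v\<alpha> show "v \<in> Q" by (simp add: Q_def)
  qed
  have disj': "quasi_periodic (h i) \<inter> quasi_periodic (h j) \<subseteq> Q" if "i \<noteq> j" for i j
    using disj[of i j] disj[of j i] that by (cases "i < j") auto
  \<comment> \<open>A vanishing combination has its sum in Q, so all its summands are in Q, and
    dividing by a nonzero coefficient would put \<open>u i\<close> itself into Q.\<close>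
  have indep: "c i = 0" if "finite I" "(\<Sum>i\<in>I. c i *s u i) = 0" "i \<in> I" for c I i
  proof (rule ccontr)
    assume c: "c i \<noteq> 0"
    have "\<forall>i\<in>I. c i *s u i \<in> Q"
      by (rule quasi_periodic_independent[OF add comm_hh Q0 Qh Qh' disj' that(1)])
        (use that(2) Q0(1) in \<open>auto intro!: quasi_periodic_scale[OF lin] u(1)\<close>)
    then have "c i *s u i \<in> Q" using that(3) by blast
    from Qs[OF this, of "inverse (c i)"] show False using u(2)[of i] c by simp
  qed
  have inj: "inj u"
  proof (rule injI, rule ccontr)
    fix i j assume eq: "u i = u j" and "i \<noteq> j"
    have "u i \<in> Q"
      using disj'[OF \<open>i \<noteq> j\<close>] u(1)[of i] u(1)[of j] unfolding eq by blast
    then show False using u(2)[of i] by simp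
  qed
  \<comment> \<open>One vector more than the dimension allows.\<close>
  define N where "N = Suc (vec.dim (UNIV :: ('f ^ 'n) set))"
  have "vec.independent (u ` {..<N})"
  proof (rule vec.independent_if_scalars_zero)
    fix f x assume f: "(\<Sum>x\<in>u ` {..<N}. f x *s x) = 0" and x: "x \<in> u ` {..<N}"
    from f have "(\<Sum>i<N. f (u i) *s u i) = 0"
      unfolding sum.reindex[OF inj_on_subset[OF inj subset_UNIV]] comp_def .
    then have "\<forall>i<N. f (u i) = 0" using indep[of "{..<N}" "\<lambda>i. f (u i)"] by blast
    then show "f x = 0" using x by blast
  qed simp
  then have "card (u ` {..<N}) \<le> vec.dim (UNIV :: ('f ^ 'n) set)"
    by (intro vec.independent_card_le_dim) auto
  moreover have "card (u ` {..<N}) = N"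
    by (simp add: card_image[OF inj_on_subset[OF inj subset_UNIV]])
  ultimately show False by (simp add: N_def)
qed

section \<open>The dual group\<close>

text \<open>Functions that differ at x are separated by the cylinders over disjoint neighbourhoods
  of their values at x. The class \<open>t2_space\<close> is what the Stone-Weierstrass locale and
  the closedness of compact sets ask for.\<close>

lemma hausdorff_fun:
  fixes f g :: "'a \<Rightarrow> 'b :: t2_space"
  assumes "f \<noteq> g"
  shows "\<exists>U V. open U \<and> open V \<and> f \<in> U \<and> g \<in> V \<and> U \<inter> V = {}"
proof -
  obtain x where "f x \<noteq> g x" using assms by auto
  then obtain U V where UV: "open U" "open V" "f x \<in> U" "g x \<in> V" "U \<inter> V = {}"
    using hausdorff by metis
  have "open {h :: 'a \<Rightarrow> 'b. h x \<in> S}" if "open S" for S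
    using product_topology_basis'[of "{()}" "\<lambda>_. S" "\<lambda>_. x"] that by simp
  then show ?thesis
    using UV by (intro exI[of _ "{h. h x \<in> U}"] exI[of _ "{h. h x \<in> V}"]) auto
qed

text \<open>
  The arities are declared class by class, as those for \<^class>\<open>t0_space\<close> and \<^class>\<open>t1_space\<close> would
  otherwise conflict with the ones that the metric on functions of a countable domain induces.
\<close>

instance "fun" :: (type, t2_space) t0_space
  by intro_classes (use hausdorff_fun in blast)

instance "fun" :: (type, t2_space) t1_space
  by intro_classes (use hausdorff_fun in blast)

instance "fun" :: (type, t2_space) t2_space
  by intro_classes (use hausdorff_fun in blast)

abbreviation characters :: "('a :: ab_group_add \<Rightarrow> complex) set" where
  "characters \<equiv> carrier dual_group"

lemma character_iff:
  "\<xi> \<in> characters \<longleftrightarrow> (\<forall>x. cmod (\<xi> x) = 1) \<and> (\<forall>x y. \<xi> (x + y) = \<xi> x * \<xi> y)"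
  by (simp add: dual_group_def)

lemma character_norm: "\<xi> \<in> characters \<Longrightarrow> cmod (\<xi> x) = 1"
  by (simp add: character_iff)

lemma character_add: "\<xi> \<in> characters \<Longrightarrow> \<xi> (x + y) = \<xi> x * \<xi> y"
  by (simp add: character_iff)

lemma character_nonzero: "\<xi> \<in> characters \<Longrightarrow> \<xi> x \<noteq> 0"
  by (metis character_norm norm_zero zero_neq_one)

lemma character_0:
  assumes "\<xi> \<in> characters" shows "\<xi> 0 = 1"
  using character_add[OF assms, of 0 0] character_nonzero[OF assms, of 0] by simp

lemma character_minus:
  assumes "\<xi> \<in> characters" shows "\<xi> (- x) = cnj (\<xi> x)"
proof -
  have "\<xi> x * cnj (\<xi> x) = \<xi> x * \<xi> (- x)"
    using character_norm[OF assms, of x] character_0[OF assms] character_add[OF assms, of x "-x"]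
    by (simp add: complex_norm_square[symmetric])
  then show ?thesis using character_nonzero[OF assms] by simp
qed

lemma character_diff: "\<xi> \<in> characters \<Longrightarrow> \<xi> (x - y) = \<xi> x * cnj (\<xi> y)"
  using character_add[of \<xi> x "-y"] character_minus[of \<xi> y] by simp

lemma character_mult:
  "\<xi> \<in> characters \<Longrightarrow> \<psi> \<in> characters \<Longrightarrow> (\<lambda>x. \<xi> x * \<psi> x) \<in> characters"
  by (simp add: character_iff norm_mult)

lemma character_cnj: "\<xi> \<in> characters \<Longrightarrow> (\<lambda>x. cnj (\<xi> x)) \<in> characters"
  by (simp add: character_iff)

lemma character_one: "(\<lambda>_. 1) \<in> characters"
  by (simp add: character_iff)

lemma character_comp: "\<xi> \<in> characters \<Longrightarrow> Modules.additive \<beta> \<Longrightarrow> \<xi> \<circ> \<beta> \<in> characters"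
  by (simp add: character_iff Modules.additive_def)

lemma cnj_mult_character: "\<xi> \<in> characters \<Longrightarrow> cnj (\<xi> x) * \<xi> x = 1"
  using character_norm[of \<xi> x] by (simp add: mult.commute complex_norm_square[symmetric])

lemma mult_dual_group: "\<xi> \<otimes>\<^bsub>dual_group\<^esub> \<psi> = (\<lambda>x. \<xi> x * \<psi> x)"
  by (simp add: dual_group_def)

lemma group_dual_group: "group (dual_group :: ('a :: ab_group_add \<Rightarrow> complex) monoid)"
proof (rule groupI)
  fix \<xi> :: "'a \<Rightarrow> complex" assume "\<xi> \<in> characters"
  then show "\<exists>\<psi>\<in>characters. \<psi> \<otimes>\<^bsub>dual_group\<^esub> \<xi> = \<one>\<^bsub>dual_group\<^esub>"
    by (intro bexI[of _ "\<lambda>x. cnj (\<xi> x)"])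
      (auto simp: mult_dual_group character_cnj cnj_mult_character, simp add: dual_group_def)
qed (auto simp: dual_group_def norm_mult)

lemma inv_dual_group:
  assumes "\<xi> \<in> characters"
  shows "inv\<^bsub>dual_group\<^esub> \<xi> = (\<lambda>x. cnj (\<xi> x))"
proof (rule group.inv_equality[OF group_dual_group _ assms character_cnj[OF assms]])
  show "(\<lambda>x. cnj (\<xi> x)) \<otimes>\<^bsub>dual_group\<^esub> \<xi> = \<one>\<^bsub>dual_group\<^esub>"
    by (simp add: mult_dual_group cnj_mult_character[OF assms]) (simp add: dual_group_def)
qed

lemma dual_topology_eq: "dual_topology = top_of_set characters"
  by (simp add: dual_topology_def euclidean_product_topology)

lemma continuous_on_eval: "continuous_on S (\<lambda>f. f x :: 'b :: topological_space)"
  by (rule continuous_on_subset[OF continuous_on_product_coordinates subset_UNIV])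

text \<open>A closed subset of a product of circles, which is compact by Tychonoff.\<close>

lemma compact_characters: "compact (characters :: ('a :: ab_group_add \<Rightarrow> complex) set)"
proof -
  have "compactin (product_topology (\<lambda>_. euclidean) UNIV)
      (Pi\<^sub>E (UNIV :: 'a set) (\<lambda>_. sphere (0 :: complex) 1))"
    by (subst compactin_PiE) simp
  then have "compact (Pi\<^sub>E (UNIV :: 'a set) (\<lambda>_. sphere (0 :: complex) 1))"
    by (simp add: euclidean_product_topology)
  moreover have "closed {\<xi> :: 'a \<Rightarrow> complex. \<forall>x y. \<xi> (x + y) = \<xi> x * \<xi> y}"
    by (intro closed_Collect_all closed_Collect_eq continuous_on_mult continuous_on_eval)
  moreover have "characters = Pi\<^sub>E (UNIV :: 'a set) (\<lambda>_. sphere (0 :: complex) 1)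
      \<inter> {\<xi>. \<forall>x y. \<xi> (x + y) = \<xi> x * \<xi> y}"
    by (auto simp: dual_group_def PiE_def Pi_def)
  ultimately show ?thesis by (simp add: compact_Int_closed)
qed

lemma openin_neighbourhood_one:
  fixes Z :: "'a :: ab_group_add set"
  assumes "finite Z"
  shows "openin (top_of_set characters) {\<xi> \<in> characters. \<forall>b\<in>Z. cmod (\<xi> b - 1) < e}"
proof -
  have "open {\<xi> :: 'a \<Rightarrow> complex. \<forall>b\<in>Z. \<xi> b \<in> ball 1 e}"
    using assms by (intro product_topology_basis') auto
  moreover have "{\<xi> \<in> characters. \<forall>b\<in>Z. cmod (\<xi> b - 1) < e} = characters \<inter> {\<xi>. \<forall>b\<in>Z. \<xi> b \<in> ball 1 e}"
    by (auto simp: dist_norm norm_minus_commute)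
  ultimately show ?thesis by (simp add: openin_open_Int)
qed

section \<open>Trigonometric polynomials\<close>

text \<open>Both rules constrain values on characters only, so membership is insensitive to values
  elsewhere. The functions are real because Stone-Weierstrass is applied to a real function ring;
  the complex coefficient c makes up for it.\<close>

inductive_set trig_polys :: "(('a :: ab_group_add \<Rightarrow> complex) \<Rightarrow> real) set" where
  monom: "(\<And>\<xi>. \<xi> \<in> characters \<Longrightarrow> f \<xi> = Re (c * \<xi> a)) \<Longrightarrow> f \<in> trig_polys"
| add: "f \<in> trig_polys \<Longrightarrow> g \<in> trig_polys \<Longrightarrow>
    (\<And>\<xi>. \<xi> \<in> characters \<Longrightarrow> h \<xi> = f \<xi> + g \<xi>) \<Longrightarrow> h \<in> trig_polys"

text \<open>The product-to-sum formula: the frequencies a and b combine to a + b and a - b.\<close>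

lemma trig_polys_mult_monom:
  assumes "g \<in> trig_polys" "\<And>\<xi>. \<xi> \<in> characters \<Longrightarrow> h \<xi> = Re (c * \<xi> a) * g \<xi>"
  shows "h \<in> trig_polys"
  using assms
proof (induction arbitrary: h)
  case (monom g d b)
  have *: "h \<xi> = Re (c * d / 2 * \<xi> (a + b)) + Re (c * cnj d / 2 * \<xi> (a - b))"
    if "\<xi> \<in> characters" for \<xi>
  proof -
    have Re_mult: "Re z * Re w = Re (z * w) / 2 + Re (z * cnj w) / 2" for z w
      by (simp add: field_simps)
    have "h \<xi> = Re (c * \<xi> a) * Re (d * \<xi> b)"
      using monom that by simp
    also have "\<dots> = Re (c * \<xi> a * (d * \<xi> b)) / 2 + Re (c * \<xi> a * cnj (d * \<xi> b)) / 2"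
      by (rule Re_mult)
    also have "c * \<xi> a * (d * \<xi> b) = 2 * (c * d / 2 * \<xi> (a + b))"
      by (simp add: character_add that)
    also have "c * \<xi> a * cnj (d * \<xi> b) = 2 * (c * cnj d / 2 * \<xi> (a - b))"
      by (simp add: character_diff that)
    finally show ?thesis by simp
  qed
  show ?case
    by (rule trig_polys.add[OF trig_polys.monom trig_polys.monom *]) (rule refl)+
next
  case (add f g k)
  show ?case
    by (rule trig_polys.add[OF add.IH(1) add.IH(2), of "\<lambda>\<xi>. Re (c * \<xi> a) * f \<xi>" "\<lambda>\<xi>. Re (c * \<xi> a) * g \<xi>"])
      (simp_all add: add.prems add.hyps(3) distrib_left)
qed

lemma trig_polys_mult:
  assumes "f \<in> trig_polys" "g \<in> trig_polys" "\<And>\<xi>. \<xi> \<in> characters \<Longrightarrow> h \<xi> = f \<xi> * g \<xi>"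
  shows "h \<in> trig_polys"
  using assms(1,3)
proof (induction arbitrary: h)
  case (monom f c a)
  then show ?case by (intro trig_polys_mult_monom[OF assms(2), of h c a]) simp
next
  case (add f1 f2 k)
  show ?case
    by (rule trig_polys.add[OF add.IH(1) add.IH(2), of "\<lambda>\<xi>. f1 \<xi> * g \<xi>" "\<lambda>\<xi>. f2 \<xi> * g \<xi>"])
      (simp_all add: add.prems add.hyps(3) distrib_right)
qed

lemma trig_polys_const: "(\<lambda>_. c) \<in> trig_polys"
  by (rule trig_polys.monom[of _ "of_real c" 0]) (simp add: character_0)

lemma trig_polys_comp:
  assumes "f \<in> trig_polys" "Modules.additive \<beta>"
  shows "(\<lambda>\<xi>. f (\<xi> \<circ> \<beta>)) \<in> trig_polys"
  using assms(1)
proof induction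
  case (monom f c a)
  show ?case
    by (rule trig_polys.monom[of _ c "\<beta> a"])
      (simp add: monom character_comp[OF _ assms(2), unfolded comp_def] comp_def)
next
  case (add f g h)
  show ?case
    by (rule trig_polys.add[OF add.IH])
      (simp add: add.hyps(3) character_comp[OF _ assms(2), unfolded comp_def] comp_def)
qed

lemma continuous_on_trig_poly:
  assumes "f \<in> trig_polys"
  shows "continuous_on characters f"
  using assms
proof induction
  case (monom f c a)
  have "continuous_on characters (\<lambda>\<xi>. Re (c * \<xi> a))"
    by (intro continuous_intros continuous_on_eval)
  then show ?case using monom by (simp cong: continuous_on_cong_simp)
next
  case (add f g h)
  then have "continuous_on characters (\<lambda>\<xi>. f \<xi> + g \<xi>)"
    by (intro continuous_intros)
  then show ?case using add.hyps(3) by (simp cong: continuous_on_cong_simp)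
qed

lemma function_ring_trig_polys:
  "function_ring_on (trig_polys :: (('a :: ab_group_add \<Rightarrow> complex) \<Rightarrow> real) set) characters"
proof
  fix \<xi> \<psi> :: "'a \<Rightarrow> complex"
  assume *: "\<xi> \<in> characters" "\<psi> \<in> characters" "\<xi> \<noteq> \<psi>"
  then obtain a where a: "\<xi> a \<noteq> \<psi> a" by auto
  \<comment> \<open>Coefficient 1 yields the real part of the value at a, coefficient \<i> the
    negative of its imaginary part.\<close>
  have "Re (1 * \<xi> a) \<noteq> Re (1 * \<psi> a) \<or> Re (\<i> * \<xi> a) \<noteq> Re (\<i> * \<psi> a)"
    using a by (auto simp: complex_eq_iff)
  moreover have "(\<lambda>\<xi>. Re (c * \<xi> a)) \<in> trig_polys" for c
    by (rule trig_polys.monom) simp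
  ultimately show "\<exists>f\<in>trig_polys. f \<xi> \<noteq> f \<psi>"
    by (elim disjE) (rule bexI[rotated], assumption, assumption)+
qed (auto intro: trig_polys.add trig_polys_mult trig_polys_const compact_characters
    continuous_on_trig_poly)

section \<open>Closed subgroups and annihilators\<close>

text \<open>A finite substitute for integration over L: the average of each frequency in S that L
  does not annihilate becomes small. Lists are used since multiplicities count.\<close>

lemma ex_list_averaging:
  fixes \<delta> :: real
  assumes L: "subgroup L dual_group" and "finite S" "\<delta> > 0"
    and S: "\<And>a. a \<in> S \<Longrightarrow> \<exists>\<xi>\<in>L. \<xi> a \<noteq> 1"
  shows "\<exists>xs. xs \<noteq> [] \<and> set xs \<subseteq> L \<and> (\<forall>a\<in>S. cmod (\<Sum>\<xi>\<leftarrow>xs. \<xi> a) \<le> \<delta> * length xs)"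
  using assms(2) S
proof (induction S rule: finite_induct)
  case empty
  then show ?case
    using subgroup.one_closed[OF L] by (intro exI[of _ "[\<one>\<^bsub>dual_group\<^esub>]"]) auto
next
  case (insert b S)
  then obtain xs where xs: "xs \<noteq> []" "set xs \<subseteq> L"
    "\<And>a. a \<in> S \<Longrightarrow> cmod (\<Sum>\<xi>\<leftarrow>xs. \<xi> a) \<le> \<delta> * length xs"
    by auto
  obtain \<psi> where \<psi>: "\<psi> \<in> L" "\<psi> b \<noteq> 1" using insert.prems by auto
  have L_char: "\<xi> \<in> characters" if "\<xi> \<in> L" for \<xi>
    using that subgroup.subset[OF L] by auto
  define d where "d = cmod (1 - \<psi> b)"
  have d: "d > 0" using \<psi> by (simp add: d_def)
  \<comment> \<open>A geometric sum of powers of \<open>\<psi> b\<close> has modulus at most 2 / d,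
    which this N makes at most \<delta> N.\<close>
  obtain N :: nat where N: "N > 2 / (\<delta> * d)" by (meson reals_Archimedean2)
  have "N > 0"
    using N d \<open>\<delta> > 0\<close> by (metis divide_pos_pos mult_pos_pos of_nat_0_less_iff order_less_trans zero_less_numeral)
  \<comment> \<open>Every entry is multiplied by the first N powers of \<psi>, so each frequency sum
    acquires a geometric factor. The factor is small relative to N at b, and at most N elsewhere,
    where the averages already obtained survive.\<close>
  define ys where "ys = concat (map (\<lambda>\<xi>. map (\<lambda>j x. \<xi> x * \<psi> x ^ j) [0..<N]) xs)"
  have sum: "(\<Sum>\<xi>\<leftarrow>ys. \<xi> a) = (\<Sum>\<xi>\<leftarrow>xs. \<xi> a) * (\<Sum>j<N. \<psi> a ^ j)" for a
    unfolding ys_def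
    by (induction xs)
      (simp_all add: comp_def distrib_right sum_distrib_left sum.distrib
        interv_sum_list_conv_sum_set_nat atLeast0LessThan)
  have len: "length ys = length xs * N"
    unfolding ys_def by (induction xs) auto
  have pow: "(\<lambda>x. \<psi> x ^ j) \<in> L" for j
  proof (induction j)
    case 0
    then show ?case using subgroup.one_closed[OF L] by (simp add: dual_group_def)
  next
    case (Suc j)
    then show ?case
      using subgroup.m_closed[OF L \<psi>(1)] by (simp add: mult_dual_group)
  qed
  have "set ys \<subseteq> L"
    using xs(2) subgroup.m_closed[OF L _ pow] by (auto simp: ys_def mult_dual_group)
  moreover have "ys \<noteq> []"
    using len xs(1) \<open>N > 0\<close> by (metis length_0_conv mult_eq_0_iff neq0_conv)
  moreover have "cmod (\<Sum>\<xi>\<leftarrow>ys. \<xi> a) \<le> \<delta> * length ys" if "a \<in> S" for a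
  proof -
    have "cmod (\<Sum>j<N. \<psi> a ^ j) \<le> (\<Sum>j<N. cmod (\<psi> a ^ j))"
      by (rule norm_sum)
    then have "cmod (\<Sum>j<N. \<psi> a ^ j) \<le> N"
      by (simp add: norm_power character_norm L_char \<psi>)
    then show ?thesis
      using mult_mono[OF xs(3)[OF that], of "cmod (\<Sum>j<N. \<psi> a ^ j)" "real N"] \<open>\<delta> > 0\<close>
      by (simp add: sum norm_mult len algebra_simps)
  qed
  moreover have "cmod (\<Sum>\<xi>\<leftarrow>ys. \<xi> b) \<le> \<delta> * length ys"
  proof -
    have "cmod (\<Sum>\<xi>\<leftarrow>xs. \<xi> b) \<le> (\<Sum>\<xi>\<leftarrow>xs. cmod (\<xi> b))"
      by (induction xs) (auto intro: norm_triangle_mono)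
    also have "(\<Sum>\<xi>\<leftarrow>xs. cmod (\<xi> b)) = (\<Sum>\<xi>\<leftarrow>xs. 1)"
      using xs(2) by (intro arg_cong[of _ _ sum_list] map_cong) (auto simp: L_char character_norm)
    finally have 1: "cmod (\<Sum>\<xi>\<leftarrow>xs. \<xi> b) \<le> length xs"
      by (simp add: sum_list_triv)
    have "d * cmod (\<Sum>j<N. \<psi> b ^ j) = cmod (1 - \<psi> b ^ N)"
      unfolding d_def norm_mult[symmetric] by (simp add: one_diff_power_eq)
    also have "\<dots> \<le> cmod 1 + cmod (\<psi> b ^ N)" by (rule norm_triangle_ineq4)
    also have "\<dots> = 2" by (simp add: norm_power character_norm L_char \<psi>)
    also have "2 \<le> d * (\<delta> * N)" using N d \<open>\<delta> > 0\<close> by (simp add: field_simps)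
    finally have "cmod (\<Sum>j<N. \<psi> b ^ j) \<le> \<delta> * N" using d by simp
    then show ?thesis
      using mult_mono[OF 1, of "cmod (\<Sum>j<N. \<psi> b ^ j)" "\<delta> * N"] \<open>\<delta> > 0\<close>
      by (simp add: sum norm_mult len algebra_simps)
  qed
  ultimately show ?case by (intro exI[of _ ys]) auto
qed

text \<open>For a monomial of frequency a the two sums differ by the real part of
  \<open>c * (1 - \<xi> a)\<close> times the sum of the \<open>\<psi> a\<close>. If L annihilates a,
  then \<open>\<xi> a = 1\<close> and the difference vanishes; otherwise a is put into S. The
  constant C collects the coefficients.\<close>

lemma trig_poly_average_translate:
  assumes "f \<in> trig_polys" "L \<subseteq> characters" "\<xi> \<in> characters"
    and \<xi>: "\<And>a. (\<And>\<psi>. \<psi> \<in> L \<Longrightarrow> \<psi> a = 1) \<Longrightarrow> \<xi> a = 1"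
  shows "\<exists>S C. finite S \<and> (\<forall>a\<in>S. \<exists>\<psi>\<in>L. \<psi> a \<noteq> 1) \<and> (\<forall>xs \<delta>. set xs \<subseteq> L \<longrightarrow>
     (\<forall>a\<in>S. cmod (\<Sum>\<psi>\<leftarrow>xs. \<psi> a) \<le> \<delta>) \<longrightarrow>
     \<bar>(\<Sum>\<psi>\<leftarrow>xs. f \<psi>) - (\<Sum>\<psi>\<leftarrow>xs. f (\<lambda>x. \<xi> x * \<psi> x))\<bar> \<le> C * \<delta>)"
  using assms(1)
proof induction
  case (monom f c a)
  \<comment> \<open>Stated for any character \<eta>, to be used with both \<xi> and the trivial
    character.\<close>
  have f: "(\<Sum>\<psi>\<leftarrow>xs. f (\<lambda>x. \<eta> x * \<psi> x)) = Re (c * \<eta> a * (\<Sum>\<psi>\<leftarrow>xs. \<psi> a))"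
    if "set xs \<subseteq> L" "\<eta> \<in> characters" for xs \<eta>
    using that(1)
  proof (induction xs)
    case (Cons \<psi> xs)
    have "f (\<lambda>x. \<eta> x * \<psi> x) = Re (c * \<eta> a * \<psi> a)"
      using Cons.prems assms(2) that(2) by (subst monom) (auto intro: character_mult simp: mult.assoc)
    with Cons show ?case by (simp add: algebra_simps)
  qed auto
  have diff: "\<bar>(\<Sum>\<psi>\<leftarrow>xs. f \<psi>) - (\<Sum>\<psi>\<leftarrow>xs. f (\<lambda>x. \<xi> x * \<psi> x))\<bar>
      \<le> cmod (c * (1 - \<xi> a)) * cmod (\<Sum>\<psi>\<leftarrow>xs. \<psi> a)" if "set xs \<subseteq> L" for xs
  proof -
    have "(\<Sum>\<psi>\<leftarrow>xs. f \<psi>) - (\<Sum>\<psi>\<leftarrow>xs. f (\<lambda>x. \<xi> x * \<psi> x))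
        = Re (c * (1 - \<xi> a) * (\<Sum>\<psi>\<leftarrow>xs. \<psi> a))"
      using f[OF that assms(3)] f[OF that character_one] by (simp add: algebra_simps)
    then show ?thesis
      using abs_Re_le_cmod[of "c * (1 - \<xi> a) * (\<Sum>\<psi>\<leftarrow>xs. \<psi> a)"] by (simp add: norm_mult)
  qed
  show ?case
  proof (cases "\<exists>\<psi>\<in>L. \<psi> a \<noteq> 1")
    case True
    have "\<bar>(\<Sum>\<psi>\<leftarrow>xs. f \<psi>) - (\<Sum>\<psi>\<leftarrow>xs. f (\<lambda>x. \<xi> x * \<psi> x))\<bar> \<le> cmod (c * (1 - \<xi> a)) * \<delta>"
      if "set xs \<subseteq> L" "cmod (\<Sum>\<psi>\<leftarrow>xs. \<psi> a) \<le> \<delta>" for xs \<delta>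
      using diff[OF that(1)] mult_left_mono[OF that(2), of "cmod (c * (1 - \<xi> a))"] by simp
    with True show ?thesis
      by (intro exI[of _ "{a}"] exI[of _ "cmod (c * (1 - \<xi> a))"]) auto
  next
    case False
    then have "\<xi> a = 1" using \<xi> by auto
    then show ?thesis
      using diff by (intro exI[of _ "{}"] exI[of _ 0]) auto
  qed
next
  case (add f g h)
  from add.IH(1) obtain S1 C1 where 1: "finite S1" "\<forall>a\<in>S1. \<exists>\<psi>\<in>L. \<psi> a \<noteq> 1"
    "\<And>xs \<delta>. set xs \<subseteq> L \<Longrightarrow> (\<forall>a\<in>S1. cmod (\<Sum>\<psi>\<leftarrow>xs. \<psi> a) \<le> \<delta>) \<Longrightarrow>
     \<bar>(\<Sum>\<psi>\<leftarrow>xs. f \<psi>) - (\<Sum>\<psi>\<leftarrow>xs. f (\<lambda>x. \<xi> x * \<psi> x))\<bar> \<le> C1 * \<delta>"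
    by meson
  from add.IH(2) obtain S2 C2 where 2: "finite S2" "\<forall>a\<in>S2. \<exists>\<psi>\<in>L. \<psi> a \<noteq> 1"
    "\<And>xs \<delta>. set xs \<subseteq> L \<Longrightarrow> (\<forall>a\<in>S2. cmod (\<Sum>\<psi>\<leftarrow>xs. \<psi> a) \<le> \<delta>) \<Longrightarrow>
     \<bar>(\<Sum>\<psi>\<leftarrow>xs. g \<psi>) - (\<Sum>\<psi>\<leftarrow>xs. g (\<lambda>x. \<xi> x * \<psi> x))\<bar> \<le> C2 * \<delta>"
    by meson
  have h: "(\<Sum>\<psi>\<leftarrow>xs. h (\<lambda>x. \<eta> x * \<psi> x))
      = (\<Sum>\<psi>\<leftarrow>xs. f (\<lambda>x. \<eta> x * \<psi> x)) + (\<Sum>\<psi>\<leftarrow>xs. g (\<lambda>x. \<eta> x * \<psi> x))"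
    if "set xs \<subseteq> L" "\<eta> \<in> characters" for xs \<eta>
  proof -
    have "(\<Sum>\<psi>\<leftarrow>xs. h (\<lambda>x. \<eta> x * \<psi> x))
        = (\<Sum>\<psi>\<leftarrow>xs. f (\<lambda>x. \<eta> x * \<psi> x) + g (\<lambda>x. \<eta> x * \<psi> x))"
      using that assms(2)
      by (intro arg_cong[of _ _ sum_list] map_cong refl add.hyps(3) character_mult) auto
    then show ?thesis by (simp add: sum_list_addf)
  qed
  show ?case
  proof (intro exI[of _ "S1 \<union> S2"] exI[of _ "C1 + C2"] conjI allI impI)
    fix xs \<delta> assume xs: "set xs \<subseteq> L" "\<forall>a\<in>S1 \<union> S2. cmod (\<Sum>\<psi>\<leftarrow>xs. \<psi> a) \<le> \<delta>"
    have b: "\<bar>(\<Sum>\<psi>\<leftarrow>xs. f \<psi>) - (\<Sum>\<psi>\<leftarrow>xs. f (\<lambda>x. \<xi> x * \<psi> x))\<bar> \<le> C1 * \<delta>"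
      "\<bar>(\<Sum>\<psi>\<leftarrow>xs. g \<psi>) - (\<Sum>\<psi>\<leftarrow>xs. g (\<lambda>x. \<xi> x * \<psi> x))\<bar> \<le> C2 * \<delta>"
      using 1(3)[OF xs(1)] 2(3)[OF xs(1)] xs(2) by auto
    show "\<bar>(\<Sum>\<psi>\<leftarrow>xs. h \<psi>) - (\<Sum>\<psi>\<leftarrow>xs. h (\<lambda>x. \<xi> x * \<psi> x))\<bar> \<le> (C1 + C2) * \<delta>"
      using h[OF xs(1) assms(3)] h[OF xs(1) character_one] b
      by (simp add: distrib_right)
  qed (use 1 2 in auto)
qed

text \<open>
  A trigonometric polynomial that separates \<open>L\<close> from its coset \<open>\<xi> L\<close> would have different averages
  on them, but the frequencies that survive averaging annihilate \<open>L\<close>, hence also \<open>\<xi>\<close>.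
\<close>

theorem closed_subgroup_annihilator:
  assumes L: "subgroup L dual_group" "closedin dual_topology L" and "\<xi> \<in> characters"
    and \<xi>: "\<And>a. (\<And>\<psi>. \<psi> \<in> L \<Longrightarrow> \<psi> a = 1) \<Longrightarrow> \<xi> a = 1"
  shows "\<xi> \<in> L"
proof (rule ccontr)
  assume "\<xi> \<notin> L"
  interpret function_ring_on trig_polys characters
    by (rule function_ring_trig_polys)
  define M where "M = (\<lambda>\<psi> x. \<xi> x * \<psi> x) ` L"
  have LK: "L \<subseteq> characters" by (rule subgroup.subset[OF L(1)])
  have cL: "compact L"
    using L(2) compact_characters closedin_compact by (auto simp: dual_topology_eq)
  have cM: "compact M"
    unfolding M_def
    by (intro compact_continuous_image cL continuous_intros continuous_on_coordinatewise_then_product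
        continuous_on_eval)
  have "L \<inter> M = {}"
  proof -
    have False if "\<psi> \<in> L" "(\<lambda>x. \<xi> x * \<psi> x) \<in> L" for \<psi>
    proof -
      have "(\<lambda>x. \<xi> x * \<psi> x) \<otimes>\<^bsub>dual_group\<^esub> inv\<^bsub>dual_group\<^esub> \<psi> \<in> L"
        by (intro subgroup.m_closed[OF L(1)] subgroup.m_inv_closed[OF L(1)] that)
      moreover have "\<psi> \<in> characters" using that(1) LK by blast
      moreover from this have "\<xi> x * \<psi> x * cnj (\<psi> x) = \<xi> x" for x
        using cnj_mult_character[of \<psi> x] by (simp add: mult.assoc mult.commute)
      ultimately show False
        using \<open>\<xi> \<notin> L\<close> by (simp add: mult_dual_group inv_dual_group)
    qed
    then show ?thesis by (auto simp: M_def)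
  qed
  moreover have "M \<subseteq> characters"
    using character_mult[OF assms(3)] LK by (auto simp: M_def)
  \<comment> \<open>The fact \<open>two\<close> is the separation step of Stone-Weierstrass: a
    member of the ring that is near 0 on one closed set and near 1 on a disjoint one.\<close>
  ultimately obtain f where f: "f \<in> trig_polys" "f ` characters \<subseteq> {0..1}"
    "\<forall>\<psi>\<in>L. f \<psi> < 1/3" "\<forall>\<psi>\<in>M. f \<psi> > 1 - 1/3"
    using two[OF compact_imp_closed[OF cL] LK compact_imp_closed[OF cM], of "1/3"] by auto
  obtain S C where SC: "finite S" "\<forall>a\<in>S. \<exists>\<psi>\<in>L. \<psi> a \<noteq> 1"
    "\<And>xs \<delta>. set xs \<subseteq> L \<Longrightarrow> (\<forall>a\<in>S. cmod (\<Sum>\<psi>\<leftarrow>xs. \<psi> a) \<le> \<delta>) \<Longrightarrow>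
     \<bar>(\<Sum>\<psi>\<leftarrow>xs. f \<psi>) - (\<Sum>\<psi>\<leftarrow>xs. f (\<lambda>x. \<xi> x * \<psi> x))\<bar> \<le> C * \<delta>"
    using trig_poly_average_translate[OF f(1) LK assms(3) \<xi>] by meson
  \<comment> \<open>On average f is at most 1/3 over L and at least 2/3 over the coset; this
    \<delta> forces the averages to within 1/6 of each other.\<close>
  define \<delta> where "\<delta> = 1 / (6 * (\<bar>C\<bar> + 1))"
  have \<delta>: "\<delta> > 0" "C * \<delta> \<le> 1/6"
    by (auto simp: \<delta>_def field_simps)
  obtain xs where xs: "xs \<noteq> []" "set xs \<subseteq> L" "\<forall>a\<in>S. cmod (\<Sum>\<psi>\<leftarrow>xs. \<psi> a) \<le> \<delta> * length xs"
    using ex_list_averaging[OF L(1) SC(1) \<delta>(1)] SC(2) by blast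
  have "(\<Sum>\<psi>\<leftarrow>xs. f \<psi>) \<le> (\<Sum>\<psi>\<leftarrow>xs. 1/3)"
    using f(3) xs(2) by (intro sum_list_mono) (auto intro: less_imp_le)
  moreover have "(\<Sum>\<psi>\<leftarrow>xs. 2/3) \<le> (\<Sum>\<psi>\<leftarrow>xs. f (\<lambda>x. \<xi> x * \<psi> x))"
    using f(4) xs(2) by (intro sum_list_mono) (force simp: M_def intro: less_imp_le)
  moreover have "\<bar>(\<Sum>\<psi>\<leftarrow>xs. f \<psi>) - (\<Sum>\<psi>\<leftarrow>xs. f (\<lambda>x. \<xi> x * \<psi> x))\<bar> \<le> C * (\<delta> * length xs)"
    by (rule SC(3)[OF xs(2,3)])
  moreover have "C * (\<delta> * length xs) \<le> 1/6 * length xs"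
    using mult_right_mono[OF \<delta>(2), of "real (length xs)"] by (simp add: mult.assoc)
  moreover have "length xs > 0" using xs(1) by simp
  ultimately show False by (simp add: sum_list_triv)
qed

section \<open>Haar measure on the dual group\<close>

locale dual_haar =
  fixes \<omega> :: "('a :: ab_group_add \<Rightarrow> complex) measure"
  assumes haar: "normalized_haar_measure dual_group dual_topology \<omega>"
begin

lemma space_haar [simp]: "space \<omega> = characters"
  using haar by (simp add: normalized_haar_measure_def dual_topology_eq)

sublocale prob_space \<omega>
  using haar by (auto simp: normalized_haar_measure_def intro: prob_spaceI)

lemma sets_haar: "sets \<omega> = sigma_sets characters {U. openin (top_of_set characters) U}"
proof -
  have "{U. openin (top_of_set characters) U} \<subseteq> Pow (characters :: ('a \<Rightarrow> complex) set)"
    by (auto dest: openin_imp_subset)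
  with haar show ?thesis
    by (simp add: normalized_haar_measure_def borel_of_topology_def dual_topology_eq
        sets_measure_of)
qed

lemma open_in_sets: "openin (top_of_set characters) U \<Longrightarrow> U \<in> sets \<omega>"
  by (auto simp: sets_haar)

lemma closed_in_sets:
  assumes "closedin (top_of_set characters) C" shows "C \<in> sets \<omega>"
proof -
  have "characters - (characters - C) \<in> sets \<omega>"
    using assms sets.compl_sets[OF open_in_sets] by (auto simp: closedin_def)
  then show ?thesis
    using closedin_imp_subset[OF assms] by (simp add: double_diff)
qed

lemma continuous_imp_measurable:
  fixes f :: "('a \<Rightarrow> complex) \<Rightarrow> 'b :: topological_space"
  assumes "continuous_on characters f"
  shows "f \<in> borel_measurable \<omega>"
proof (rule borel_measurableI)
  fix S :: "'b set" assume "open S"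
  then show "f -` S \<inter> space \<omega> \<in> sets \<omega>"
    using continuous_openin_preimage_gen[OF assms, of S] by (auto intro!: open_in_sets simp: Int_commute)
qed

lemma continuous_imp_integrable:
  fixes f :: "('a \<Rightarrow> complex) \<Rightarrow> 'b :: {banach, second_countable_topology}"
  assumes "continuous_on characters f"
  shows "integrable \<omega> f"
proof -
  have "bounded (f ` characters)"
    by (intro compact_imp_bounded compact_continuous_image assms compact_characters)
  then obtain B where "\<forall>\<xi>\<in>characters. norm (f \<xi>) \<le> B"
    by (auto simp: bounded_iff)
  then show ?thesis
    by (intro integrable_const_bound[of _ B] continuous_imp_measurable assms) (auto intro: AE_I2)
qed

lemma trig_poly_integrable: "f \<in> trig_polys \<Longrightarrow> integrable \<omega> f"
  by (intro continuous_imp_integrable continuous_on_trig_poly)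

lemma continuous_self_map_measurable:
  assumes "continuous_on characters \<tau>" "\<tau> \<in> characters \<rightarrow> characters"
  shows "\<tau> \<in> measurable \<omega> \<omega>"
proof (rule measurable_sigma_sets[OF sets_haar])
  fix U :: "('a \<Rightarrow> complex) set" assume "U \<in> {U. openin (top_of_set characters) U}"
  then show "\<tau> -` U \<inter> space \<omega> \<in> sets \<omega>"
    using continuous_openin_preimage[OF assms] by (auto intro!: open_in_sets simp: Int_commute)
qed (use assms in \<open>auto dest: openin_imp_subset\<close>)

lemma continuous_on_translate: "continuous_on S (\<lambda>\<xi> x. \<psi> x * \<xi> x :: complex)"
  by (intro continuous_on_coordinatewise_then_product continuous_on_mult continuous_on_const continuous_on_eval)

text \<open>The Haar axiom speaks of images, whereas measurability and \<open>distr\<close> speak of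
  preimages; this mediates between them.\<close>

lemma translate_image_eq:
  assumes \<psi>: "\<psi> \<in> characters" and "A \<subseteq> characters"
  shows "(\<lambda>\<xi> x. \<psi> x * \<xi> x) ` A = (\<lambda>\<xi> x. cnj (\<psi> x) * \<xi> x) -` A \<inter> characters"
proof (intro equalityI subsetI)
  have cancel: "cnj (\<psi> x) * (\<psi> x * z) = z" "\<psi> x * (cnj (\<psi> x) * z) = z" for x z
    using cnj_mult_character[OF \<psi>, of x] by (metis mult.assoc mult.commute mult_1)+
  fix \<xi>
  show "\<xi> \<in> (\<lambda>\<xi> x. \<psi> x * \<xi> x) ` A"
    if "\<xi> \<in> (\<lambda>\<xi> x. cnj (\<psi> x) * \<xi> x) -` A \<inter> characters"
    using that by (intro image_eqI[of _ _ "\<lambda>x. cnj (\<psi> x) * \<xi> x"]) (auto simp: cancel)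
  show "\<xi> \<in> (\<lambda>\<xi> x. cnj (\<psi> x) * \<xi> x) -` A \<inter> characters"
    if "\<xi> \<in> (\<lambda>\<xi> x. \<psi> x * \<xi> x) ` A"
    using that assms character_mult[OF \<psi>] by (auto simp: cancel)
qed

lemma translate_measurable:
  "\<psi> \<in> characters \<Longrightarrow> (\<lambda>\<xi> x. \<psi> x * \<xi> x) \<in> measurable \<omega> \<omega>"
  by (intro continuous_self_map_measurable continuous_on_translate) (auto intro: character_mult)

lemma
  assumes \<psi>: "\<psi> \<in> characters" and A: "A \<in> sets \<omega>"
  shows translate_in_sets: "(\<lambda>\<xi> x. \<psi> x * \<xi> x) ` A \<in> sets \<omega>"
    and emeasure_translate: "emeasure \<omega> ((\<lambda>\<xi> x. \<psi> x * \<xi> x) ` A) = emeasure \<omega> A"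
proof -
  have "A \<subseteq> characters" using sets.sets_into_space[OF A] by simp
  then show "(\<lambda>\<xi> x. \<psi> x * \<xi> x) ` A \<in> sets \<omega>"
    using measurable_sets[OF translate_measurable[OF character_cnj[OF \<psi>]] A]
    by (simp add: translate_image_eq[OF \<psi>])
  show "emeasure \<omega> ((\<lambda>\<xi> x. \<psi> x * \<xi> x) ` A) = emeasure \<omega> A"
    using haar A \<psi> by (auto simp: normalized_haar_measure_def mult_dual_group)
qed

lemma distr_translate:
  assumes \<psi>: "\<psi> \<in> characters"
  shows "distr \<omega> \<omega> (\<lambda>\<xi> x. \<psi> x * \<xi> x) = \<omega>"
proof (rule measure_eqI)
  fix A assume "A \<in> sets (distr \<omega> \<omega> (\<lambda>\<xi> x. \<psi> x * \<xi> x))"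
  then have A: "A \<in> sets \<omega>" by simp
  then have "A \<subseteq> characters" using sets.sets_into_space by fastforce
  then have "(\<lambda>\<xi> x. \<psi> x * \<xi> x) -` A \<inter> space \<omega> = (\<lambda>\<xi> x. cnj (\<psi> x) * \<xi> x) ` A"
    using translate_image_eq[OF character_cnj[OF \<psi>]] by simp
  then show "emeasure (distr \<omega> \<omega> (\<lambda>\<xi> x. \<psi> x * \<xi> x)) A = emeasure \<omega> A"
    using emeasure_distr[OF translate_measurable[OF \<psi>] A]
      emeasure_translate[OF character_cnj[OF \<psi>] A] by simp
qed simp

text \<open>By compactness finitely many translates of U cover the group, so a null set U would make
  the whole group null.\<close>

lemma measure_open_pos:
  assumes U: "openin (top_of_set characters) U" "U \<noteq> {}"
  shows "measure \<omega> U > 0"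
proof (rule ccontr)
  assume "\<not> measure \<omega> U > 0"
  then have "emeasure \<omega> U = 0"
    using measure_nonneg[of \<omega> U] by (simp add: emeasure_eq_measure)
  have UK: "U \<subseteq> characters" using openin_imp_subset[OF U(1)] .
  obtain \<eta> where \<eta>: "\<eta> \<in> U" using U by auto
  then have \<eta>': "\<eta> \<in> characters" using UK by auto
  define \<C> where "\<C> = (\<lambda>\<psi>. (\<lambda>\<xi> x. \<psi> x * \<xi> x) ` U) ` characters"
  have "openin (top_of_set characters) ((\<lambda>\<xi> x. \<psi> x * \<xi> x) ` U)" if "\<psi> \<in> characters" for \<psi>
    using continuous_openin_preimage[OF continuous_on_translate[of characters "\<lambda>x. cnj (\<psi> x)"] _ U(1)]
      character_mult[OF character_cnj[OF that]]
    by (auto simp: translate_image_eq[OF that UK] Int_commute)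
  then have "\<forall>c\<in>\<C>. openin (top_of_set characters) c"
    by (auto simp: \<C>_def)
  moreover have "characters \<subseteq> \<Union>\<C>"
  proof
    fix \<xi> :: "'a \<Rightarrow> complex" assume \<xi>: "\<xi> \<in> characters"
    have "\<xi> = (\<lambda>x. \<xi> x * cnj (\<eta> x) * \<eta> x)"
      by (simp only: mult.assoc cnj_mult_character[OF \<eta>'] mult_1_right)
    then have "\<xi> \<in> (\<lambda>\<zeta> x. (\<xi> x * cnj (\<eta> x)) * \<zeta> x) ` U"
      using \<eta> by (rule image_eqI)
    then show "\<xi> \<in> \<Union>\<C>"
      using character_mult[OF \<xi> character_cnj[OF \<eta>']] by (auto simp: \<C>_def)
  qed
  ultimately obtain \<D> where \<D>: "\<D> \<subseteq> \<C>" "finite \<D>" "characters \<subseteq> \<Union>\<D>"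
    using compact_characters unfolding compact_eq_openin_cover by meson
  have "c \<in> null_sets \<omega>" if "c \<in> \<C>" for c
    using that \<open>emeasure \<omega> U = 0\<close> emeasure_translate[OF _ open_in_sets[OF U(1)]]
      translate_in_sets[OF _ open_in_sets[OF U(1)]]
    by (auto simp: \<C>_def null_sets_def)
  then have "\<Union>\<D> \<in> null_sets \<omega>"
    using \<D> by (intro null_sets.finite_Union) auto
  moreover have "space \<omega> \<subseteq> \<Union>\<D>" using \<D>(3) by simp
  ultimately have "emeasure \<omega> (space \<omega>) \<le> 0"
    by (metis emeasure_mono null_setsD1 null_setsD2)
  then show False using emeasure_space_1 by simp
qed

text \<open>Translation by \<psi> leaves the integral unchanged and also multiplies it by
  \<open>\<psi> a\<close>.\<close>

lemma integral_character:
  assumes "\<psi> \<in> characters" "\<psi> a \<noteq> 1"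
  shows "(LINT \<xi>|\<omega>. \<xi> a) = 0"
proof -
  have "(LINT \<xi>|\<omega>. \<xi> a) = (LINT \<xi>|distr \<omega> \<omega> (\<lambda>\<xi> x. \<psi> x * \<xi> x). \<xi> a)"
    by (simp add: distr_translate[OF assms(1)])
  also have "\<dots> = (LINT \<xi>|\<omega>. \<psi> a * \<xi> a)"
    using character_mult[OF assms(1)]
    by (intro integral_distr continuous_self_map_measurable continuous_on_translate
        continuous_imp_measurable continuous_on_eval) auto
  finally have "(1 - \<psi> a) * (LINT \<xi>|\<omega>. \<xi> a) = 0"
    by (simp add: algebra_simps)
  then show ?thesis using assms(2) by simp
qed

text \<open>The right-hand side does not mention \<omega>: all Haar measures agree on monomials,
  which is the source of uniqueness. The condition on a is phrased through characters, so separation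
  of points is not presupposed.\<close>

lemma integral_monom:
  "(LINT \<xi>|\<omega>. Re (c * \<xi> a)) = (if \<exists>\<psi>\<in>characters. \<psi> a \<noteq> 1 then 0 else Re c)"
proof (cases "\<exists>\<psi>\<in>characters. \<psi> a \<noteq> 1")
  case True
  have "integrable \<omega> (\<lambda>\<xi>. c * \<xi> a)"
    by (intro continuous_imp_integrable continuous_on_mult continuous_on_const continuous_on_eval)
  then have "(LINT \<xi>|\<omega>. Re (c * \<xi> a)) = Re (LINT \<xi>|\<omega>. c * \<xi> a)"
    by (rule integral_Re)
  then show ?thesis using True integral_character[of _ a] by auto
next
  case False
  then have "(LINT \<xi>|\<omega>. Re (c * \<xi> a)) = (LINT \<xi>|\<omega>. Re c)"
    by (intro Bochner_Integration.integral_cong) auto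
  then show ?thesis using False by (simp add: prob_space[unfolded space_haar])
qed

lemma trig_poly_integral_add:
  assumes "f \<in> trig_polys" "g \<in> trig_polys" "\<And>\<xi>. \<xi> \<in> characters \<Longrightarrow> h \<xi> = f \<xi> + g \<xi>"
  shows "integral\<^sup>L \<omega> h = integral\<^sup>L \<omega> f + integral\<^sup>L \<omega> g"
proof -
  have "integral\<^sup>L \<omega> h = (LINT \<xi>|\<omega>. f \<xi> + g \<xi>)"
    using assms(3) by (intro Bochner_Integration.integral_cong) auto
  then show ?thesis
    using trig_poly_integrable[OF assms(1)] trig_poly_integrable[OF assms(2)] by simp
qed

text \<open>Outer regularity of A gives U; outer regularity of the complement gives an open set
  whose complement is C. Each costs e / 2.\<close>

lemma ex_closed_open_approx:
  assumes A: "A \<in> sets \<omega>" and "e > 0"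
  shows "\<exists>C U. closedin (top_of_set characters) C \<and> openin (top_of_set characters) U \<and>
    C \<subseteq> A \<and> A \<subseteq> U \<and> measure \<omega> (U - C) < e"
proof -
  have outer: "\<exists>U. openin (top_of_set characters) U \<and> B \<subseteq> U \<and> measure \<omega> U < measure \<omega> B + e / 2"
    if B: "B \<in> sets \<omega>" for B
  proof -
    have "(INF U \<in> {U. openin (top_of_set characters) U \<and> B \<subseteq> U}. emeasure \<omega> U) = emeasure \<omega> B"
      using haar B by (simp add: normalized_haar_measure_def dual_topology_eq)
    also have "\<dots> < ennreal (measure \<omega> B + e / 2)"
      using \<open>e > 0\<close> by (simp add: emeasure_eq_measure ennreal_lessI)
    finally obtain U where "openin (top_of_set characters) U" "B \<subseteq> U"
      "emeasure \<omega> U < ennreal (measure \<omega> B + e / 2)"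
      by (auto simp: INF_less_iff)
    then show ?thesis
      by (auto simp: emeasure_eq_measure ennreal_less_iff)
  qed
  obtain U where U: "openin (top_of_set characters) U" "A \<subseteq> U" "measure \<omega> U < measure \<omega> A + e / 2"
    using outer[OF A] by auto
  have A': "characters - A \<in> sets \<omega>" "A \<subseteq> characters"
    using A sets.compl_sets[OF A] sets.sets_into_space[OF A] by auto
  obtain V where V: "openin (top_of_set characters) V" "characters - A \<subseteq> V"
    "measure \<omega> V < measure \<omega> (characters - A) + e / 2"
    using outer[OF A'(1)] by auto
  have compl: "measure \<omega> (characters - B) = 1 - measure \<omega> B" if "B \<in> sets \<omega>" for B
    using prob_compl[OF that] by simp
  define C where "C = characters - V"
  have C: "closedin (top_of_set characters) C" "C \<subseteq> A"
    using V A' by (auto simp: C_def)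
  have "measure \<omega> (U - C) = measure \<omega> U - measure \<omega> C"
    using C U closed_in_sets open_in_sets by (intro finite_measure_Diff) auto
  also have "measure \<omega> C = 1 - measure \<omega> V"
    unfolding C_def using V(1) by (intro compl open_in_sets)
  also have "measure \<omega> U - (1 - measure \<omega> V) < e"
    using U(3) V(3) compl[OF A] by simp
  finally show ?thesis using C U by blast
qed

end

text \<open>One f serves both measures, as uniqueness compares the integrals of a single f. Outside
  \<open>U - C\<close> the pointwise error is at most e / 2; on \<open>U - C\<close> it is at most
  1, and this set has measure at most e / 2 for either measure.\<close>

lemma ex_trig_poly_approx:
  assumes "dual_haar M" "dual_haar N" and A: "A \<in> sets M" and "e > 0"
  shows "\<exists>f\<in>trig_polys. f ` characters \<subseteq> {0..1} \<and>
    (\<forall>\<mu>\<in>{M, N}. (LINT \<xi>|\<mu>. \<bar>indicator A \<xi> - f \<xi>\<bar>) \<le> e)"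
proof -
  interpret M: dual_haar M by fact
  interpret N: dual_haar N by fact
  interpret function_ring_on trig_polys "characters :: ('a \<Rightarrow> complex) set"
    by (rule function_ring_trig_polys)
  have sets: "sets N = sets M" by (simp add: M.sets_haar N.sets_haar)
  obtain C1 U1 where 1: "closedin (top_of_set characters) C1" "openin (top_of_set characters) U1"
    "C1 \<subseteq> A" "A \<subseteq> U1" "measure M (U1 - C1) < e / 2"
    using M.ex_closed_open_approx[OF A, of "e / 2"] \<open>e > 0\<close> by auto
  obtain C2 U2 where 2: "closedin (top_of_set characters) C2" "openin (top_of_set characters) U2"
    "C2 \<subseteq> A" "A \<subseteq> U2" "measure N (U2 - C2) < e / 2"
    using N.ex_closed_open_approx[of A "e / 2"] A \<open>e > 0\<close> by (auto simp: sets)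
  define C where "C = C1 \<union> C2"
  define U where "U = U1 \<inter> U2"
  have C: "closedin (top_of_set characters) C" and U: "openin (top_of_set characters) U"
    using 1 2 by (auto simp: C_def U_def)
  have CA: "C \<subseteq> A" "A \<subseteq> U" using 1 2 by (auto simp: C_def U_def)
  have closed: "closed S" if "closedin (top_of_set characters) S" for S :: "('a \<Rightarrow> complex) set"
    using that closedin_compact[OF compact_characters] compact_imp_closed by blast
  have "closedin (top_of_set characters) (characters - U)"
    using U by (simp add: closedin_def openin_imp_subset double_diff)
  \<comment> \<open>The minimum with 1 / 2 keeps the tolerance below 1 even for large e.\<close>
  then have "\<exists>f\<in>trig_polys. f ` characters \<subseteq> {0..1} \<and>
      (\<forall>x\<in>characters - U. f x < min (e / 2) (1 / 2)) \<and> (\<forall>x\<in>C. f x > 1 - min (e / 2) (1 / 2))"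
    using \<open>e > 0\<close> CA closedin_imp_subset[OF C] C by (intro two closed) auto
  then obtain f where f: "f \<in> trig_polys" "f ` characters \<subseteq> {0..1}"
    and f_less: "\<forall>x\<in>characters - U. f x < min (e / 2) (1 / 2)"
    and f_gt: "\<forall>x\<in>C. f x > 1 - min (e / 2) (1 / 2)"
    by blast
  have bound: "\<bar>indicator A \<xi> - f \<xi>\<bar> \<le> e / 2 + indicator (U - C) \<xi>" if "\<xi> \<in> characters" for \<xi>
  proof -
    have "f \<xi> \<in> {0..1}" using f(2) that by blast
    then show ?thesis
      using bspec[OF f_less, of \<xi>] bspec[OF f_gt, of \<xi>] that CA \<open>e > 0\<close>
      by (cases "\<xi> \<in> C"; cases "\<xi> \<in> U"; cases "\<xi> \<in> A") (auto simp: indicator_def)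
  qed
  have "(LINT \<xi>|\<mu>. \<bar>indicator A \<xi> - f \<xi>\<bar>) \<le> e"
    if \<mu>: "dual_haar \<mu>" "measure \<mu> (U - C) \<le> e / 2" "sets \<mu> = sets M" for \<mu>
  proof -
    interpret dual_haar \<mu> by fact
    have int: "integrable \<mu> (\<lambda>\<xi>. indicator A \<xi> - f \<xi>)"
      using trig_poly_integrable[OF f(1)] A \<mu>(3)
      by (intro Bochner_Integration.integrable_diff integrable_real_indicator)
        (auto simp: emeasure_eq_measure)
    have UC: "U - C \<in> sets \<mu>"
      using open_in_sets[OF U] closed_in_sets[OF C] by auto
    then have int': "integrable \<mu> (indicator (U - C) :: _ \<Rightarrow> real)"
      by (intro integrable_real_indicator) (auto simp: emeasure_eq_measure)
    have "(LINT \<xi>|\<mu>. \<bar>indicator A \<xi> - f \<xi>\<bar>) \<le> (LINT \<xi>|\<mu>. e / 2 + indicator (U - C) \<xi>)"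
      using bound
      by (intro integral_mono integrable_abs[OF int] Bochner_Integration.integrable_add[OF _ int'])
        (simp_all only: integrable_const space_haar)
    also have "\<dots> = e / 2 + measure \<mu> (U - C)"
      using prob_space sets.sets_into_space[OF UC]
      by (subst Bochner_Integration.integral_add[OF _ int']) (simp_all add: Int_absorb1 Int_absorb2)
    finally show ?thesis using \<mu>(2) by simp
  qed
  moreover have "measure M (U - C) \<le> e / 2"
  proof -
    have "measure M (U - C) \<le> measure M (U1 - C1)"
      using M.open_in_sets[OF 1(2)] M.closed_in_sets[OF 1(1)]
      by (intro M.finite_measure_mono) (auto simp: C_def U_def)
    then show ?thesis using 1(5) by simp
  qed
  moreover have "measure N (U - C) \<le> e / 2"
  proof -
    have "measure N (U - C) \<le> measure N (U2 - C2)"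
      using N.open_in_sets[OF 2(2)] N.closed_in_sets[OF 2(1)]
      by (intro N.finite_measure_mono) (auto simp: C_def U_def)
    then show ?thesis using 2(5) by simp
  qed
  ultimately show ?thesis
    using f(1,2) assms(1,2) sets by (intro bexI[of _ f]) auto
qed

section \<open>Uniqueness of Haar measure and its invariance under automorphisms\<close>

lemma (in dual_haar) abs_measure_diff_integral_le:
  assumes "A \<in> sets \<omega>" "f \<in> trig_polys"
  shows "\<bar>measure \<omega> A - integral\<^sup>L \<omega> f\<bar> \<le> (LINT \<xi>|\<omega>. \<bar>indicator A \<xi> - f \<xi>\<bar>)"
proof -
  have int: "integrable \<omega> (indicator A :: _ \<Rightarrow> real)"
    using assms(1) by (simp add: emeasure_eq_measure)
  have "measure \<omega> A - integral\<^sup>L \<omega> f = (LINT \<xi>|\<omega>. indicator A \<xi> - f \<xi>)"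
    using int trig_poly_integrable[OF assms(2)] sets.sets_into_space[OF assms(1)]
    by (simp add: Int_absorb1 Int_absorb2)
  then show ?thesis
    using integral_abs_bound[of \<omega> "\<lambda>\<xi>. indicator A \<xi> - f \<xi>"] by simp
qed

text \<open>The integrals of trigonometric polynomials coincide, and every measurable set is
  approximated by such a polynomial for both measures at once.\<close>

lemma dual_haar_unique:
  assumes "dual_haar M" "dual_haar N"
  shows "M = N"
proof -
  interpret M: dual_haar M by fact
  interpret N: dual_haar N by fact
  have sets: "sets N = sets M" by (simp add: M.sets_haar N.sets_haar)
  have int: "integral\<^sup>L M f = integral\<^sup>L N f" if "f \<in> trig_polys" for f
    using that
  proof induction
    case (monom f c a)
    have "integral\<^sup>L M f = (LINT \<xi>|M. Re (c * \<xi> a))" "integral\<^sup>L N f = (LINT \<xi>|N. Re (c * \<xi> a))"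
      using monom by (auto intro!: Bochner_Integration.integral_cong)
    then show ?case by (simp only: M.integral_monom N.integral_monom)
  next
    case (add f g h)
    show ?case
      using M.trig_poly_integral_add[OF add.hyps] N.trig_poly_integral_add[OF add.hyps] add.IH by simp
  qed
  have "measure M A = measure N A" if A: "A \<in> sets M" for A
  proof (rule ccontr)
    assume "measure M A \<noteq> measure N A"
    \<comment> \<open>Each of the two measures contributes an error of at most e.\<close>
    then obtain e where e: "e > 0" "2 * e < \<bar>measure M A - measure N A\<bar>"
      using field_sum_of_halves by (metis dense less_divide_eq_numeral1(1) mult.commute mult_zero_left zero_less_abs_iff right_minus_eq)
    obtain f where f: "f \<in> trig_polys" "\<forall>\<mu>\<in>{M, N}. (LINT \<xi>|\<mu>. \<bar>indicator A \<xi> - f \<xi>\<bar>) \<le> e"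
      using ex_trig_poly_approx[OF assms A e(1)] by auto
    then show False
      using M.abs_measure_diff_integral_le[OF A f(1)] N.abs_measure_diff_integral_le[of A f] int[OF f(1)] e A
      by (auto simp: sets)
  qed
  then show ?thesis
    by (intro measure_eqI) (auto simp: M.emeasure_eq_measure N.emeasure_eq_measure sets)
qed

context dual_haar
begin

text \<open>The push-forward is again a normalized Haar measure, so uniqueness identifies it with
  \<omega>.\<close>

lemma distr_automorphism:
  assumes cont: "continuous_on characters \<tau>" "continuous_on characters \<sigma>"
    and maps: "\<tau> \<in> characters \<rightarrow> characters" "\<sigma> \<in> characters \<rightarrow> characters"
    and inverse: "\<And>\<xi>. \<xi> \<in> characters \<Longrightarrow> \<sigma> (\<tau> \<xi>) = \<xi>" "\<And>\<xi>. \<xi> \<in> characters \<Longrightarrow> \<tau> (\<sigma> \<xi>) = \<xi>"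
    and mult: "\<And>\<xi> \<psi>. \<xi> \<in> characters \<Longrightarrow> \<psi> \<in> characters \<Longrightarrow>
      \<tau> (\<lambda>x. \<xi> x * \<psi> x) = (\<lambda>x. \<tau> \<xi> x * \<tau> \<psi> x)"
  shows "distr \<omega> \<omega> \<tau> = \<omega>"
proof -
  note meas = continuous_self_map_measurable[OF cont(1) maps(1)]
  have emeasure: "emeasure (distr \<omega> \<omega> \<tau>) A = emeasure \<omega> (\<tau> -` A \<inter> characters)" if "A \<in> sets \<omega>" for A
    using emeasure_distr[OF meas that] by simp
  have "normalized_haar_measure dual_group dual_topology (distr \<omega> \<omega> \<tau>)"
    unfolding normalized_haar_measure_def
  proof (intro conjI ballI)
    show "sets (distr \<omega> \<omega> \<tau>) = sets (borel_of_topology dual_topology)"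
      using haar by (simp add: normalized_haar_measure_def)
    show "space (distr \<omega> \<omega> \<tau>) = topspace dual_topology"
      by (simp add: dual_topology_eq)
    show "emeasure (distr \<omega> \<omega> \<tau>) (space (distr \<omega> \<omega> \<tau>)) = 1"
      using prob_space.emeasure_space_1[OF prob_space_distr[OF meas]] .
  next
    fix \<psi> :: "'a \<Rightarrow> complex" and A assume \<psi>: "\<psi> \<in> carrier dual_group" and "A \<in> sets (distr \<omega> \<omega> \<tau>)"
    then have A: "A \<in> sets \<omega>" by simp
    then have A': "A \<subseteq> characters" using sets.sets_into_space by fastforce
    have \<sigma>\<psi>: "\<sigma> \<psi> \<in> characters" using maps \<psi> by auto
    \<comment> \<open>Translation by \<psi> downstairs is translation by
      \<open>\<sigma> \<psi>\<close> upstairs, which \<omega> does not notice.\<close>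
    have "\<tau> -` ((\<lambda>\<xi> x. \<psi> x * \<xi> x) ` A) \<inter> characters
        = (\<lambda>\<xi> x. \<sigma> \<psi> x * \<xi> x) ` (\<tau> -` A \<inter> characters)"
    proof (intro equalityI subsetI)
      fix \<xi> assume "\<xi> \<in> \<tau> -` ((\<lambda>\<xi> x. \<psi> x * \<xi> x) ` A) \<inter> characters"
      then obtain \<eta> where \<eta>: "\<eta> \<in> A" "\<tau> \<xi> = (\<lambda>x. \<psi> x * \<eta> x)" and \<xi>: "\<xi> \<in> characters" by auto
      have \<eta>': "\<eta> \<in> characters" "\<sigma> \<eta> \<in> characters" using \<eta> A' maps by auto
      have "\<tau> (\<lambda>x. \<sigma> \<psi> x * \<sigma> \<eta> x) = \<tau> \<xi>"
        using \<eta> \<psi> \<eta>' by (simp add: mult \<sigma>\<psi> inverse)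
      then have "(\<lambda>x. \<sigma> \<psi> x * \<sigma> \<eta> x) = \<xi>"
        by (metis inverse(1) \<xi> character_mult \<sigma>\<psi> \<eta>'(2))
      then show "\<xi> \<in> (\<lambda>\<xi> x. \<sigma> \<psi> x * \<xi> x) ` (\<tau> -` A \<inter> characters)"
        using \<eta> \<eta>' by (intro image_eqI[of _ _ "\<sigma> \<eta>"]) (auto simp: inverse)
    qed (auto simp: mult \<sigma>\<psi> \<psi> inverse character_mult)
    then have "emeasure (distr \<omega> \<omega> \<tau>) ((\<lambda>\<xi> x. \<psi> x * \<xi> x) ` A) = emeasure (distr \<omega> \<omega> \<tau>) A"
      using translate_in_sets[OF \<psi> A] emeasure_translate[OF \<sigma>\<psi>, of "\<tau> -` A \<inter> characters"]
        measurable_sets[OF meas A] A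
      by (simp add: emeasure)
    then show "emeasure (distr \<omega> \<omega> \<tau>) ((\<lambda>x. \<psi> \<otimes>\<^bsub>dual_group\<^esub> x) ` A) = emeasure (distr \<omega> \<omega> \<tau>) A"
      by (simp add: mult_dual_group)
  next
    fix A assume "A \<in> sets (distr \<omega> \<omega> \<tau>)"
    then have A: "A \<in> sets \<omega>" by simp
    then have A': "A \<subseteq> characters" using sets.sets_into_space by fastforce
    let ?O = "\<lambda>A. {U. openin (top_of_set characters) U \<and> A \<subseteq> U}"
    have opre: "openin (top_of_set characters) (\<rho> -` U \<inter> characters)"
      if "openin (top_of_set characters) U" "continuous_on characters \<rho>" "\<rho> \<in> characters \<rightarrow> characters"
      for \<rho> U
      using continuous_openin_preimage[OF that(2,3,1)] by (simp add: Int_commute)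
    have "emeasure (distr \<omega> \<omega> \<tau>) A = (INF V\<in>?O (\<tau> -` A \<inter> characters). emeasure \<omega> V)"
      using haar measurable_sets[OF meas A] unfolding emeasure[OF A]
      by (simp add: normalized_haar_measure_def dual_topology_eq)
    \<comment> \<open>Regularity is transported by the homeomorphism: the open sets around the
      preimage of A are exactly the preimages of the open sets around A.\<close>
    also have "\<dots> = (INF U\<in>?O A. emeasure (distr \<omega> \<omega> \<tau>) U)"
    proof (rule antisym)
      show "(INF V\<in>?O (\<tau> -` A \<inter> characters). emeasure \<omega> V) \<le> (INF U\<in>?O A. emeasure (distr \<omega> \<omega> \<tau>) U)"
      proof (rule INF_greatest)
        fix U assume U: "U \<in> ?O A"
        then have "emeasure (distr \<omega> \<omega> \<tau>) U = emeasure \<omega> (\<tau> -` U \<inter> characters)"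
          by (intro emeasure open_in_sets) auto
        then show "(INF V\<in>?O (\<tau> -` A \<inter> characters). emeasure \<omega> V) \<le> emeasure (distr \<omega> \<omega> \<tau>) U"
          using U opre[OF _ cont(1) maps(1), of U] by (auto intro!: INF_lower)
      qed
      show "(INF U\<in>?O A. emeasure (distr \<omega> \<omega> \<tau>) U) \<le> (INF V\<in>?O (\<tau> -` A \<inter> characters). emeasure \<omega> V)"
      proof (rule INF_greatest)
        fix V assume V: "V \<in> ?O (\<tau> -` A \<inter> characters)"
        let ?U = "\<sigma> -` V \<inter> characters"
        have U: "openin (top_of_set characters) ?U"
          using V cont maps by (intro opre) auto
        have "V \<subseteq> characters" using V by (auto dest: openin_imp_subset)
        then have "\<tau> -` ?U \<inter> characters = V"
          using inverse maps by auto
        then have "emeasure (distr \<omega> \<omega> \<tau>) ?U = emeasure \<omega> V"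
          using emeasure[OF open_in_sets[OF U]] by simp
        moreover have "A \<subseteq> ?U"
          using V A' inverse maps by fastforce
        ultimately show "(INF U\<in>?O A. emeasure (distr \<omega> \<omega> \<tau>) U) \<le> emeasure \<omega> V"
          using U by (intro INF_lower2[of ?U]) auto
      qed
    qed
    finally show "emeasure (distr \<omega> \<omega> \<tau>) A
        = (INF U\<in>{U. openin dual_topology U \<and> A \<subseteq> U}. emeasure (distr \<omega> \<omega> \<tau>) U)"
      by (simp add: dual_topology_eq)
  qed
  then show ?thesis
    by (intro dual_haar_unique dual_haar_axioms) (simp add: dual_haar_def)
qed

section \<open>Mixing\<close>

lemma distr_comp:
  assumes "Modules.additive \<beta>" "bij \<beta>"
  shows "distr \<omega> \<omega> (\<lambda>\<xi>. \<xi> \<circ> \<beta>) = \<omega>"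
proof (rule distr_automorphism[where \<sigma> = "\<lambda>\<xi>. \<xi> \<circ> inv_into UNIV \<beta>"])
  have inv: "\<beta> (inv_into UNIV \<beta> v) = v" "inv_into UNIV \<beta> (\<beta> v) = v" for v
    using assms(2) by (auto simp: bij_is_inj bij_is_surj surj_f_inv_f)
  have add: "Modules.additive (inv_into UNIV \<beta>)"
    unfolding Modules.additive_def by (metis additive.add[OF assms(1)] inv)
  show "(\<lambda>\<xi>. \<xi> \<circ> \<beta>) \<in> characters \<rightarrow> characters" "(\<lambda>\<xi>. \<xi> \<circ> inv_into UNIV \<beta>) \<in> characters \<rightarrow> characters"
    by (auto intro: character_comp add assms(1))
  show "continuous_on characters (\<lambda>\<xi>. \<xi> \<circ> \<beta>)" "continuous_on characters (\<lambda>\<xi>. \<xi> \<circ> inv_into UNIV \<beta>)"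
    unfolding comp_def
    by (intro continuous_on_coordinatewise_then_product continuous_on_eval)+
qed (use assms in \<open>auto simp: fun_eq_iff bij_is_inj bij_is_surj surj_f_inv_f\<close>)

text \<open>For monomials of frequencies a and b the product has the frequencies
  \<open>a + \<beta>^n b\<close> and \<open>a - \<beta>^n b\<close>, and only frequency 0
  contributes to the integral. The equality is exact for large n, so it passes to finite sums
  without any estimate.\<close>

lemma trig_polys_mixing:
  assumes sep: "\<And>a :: 'a. a \<noteq> 0 \<Longrightarrow> \<exists>\<psi>\<in>characters. \<psi> a \<noteq> 1"
    and \<beta>: "Modules.additive \<beta>" "inj \<beta>"
    and aperiodic: "\<And>a k. a \<noteq> 0 \<Longrightarrow> k > 0 \<Longrightarrow> (\<beta> ^^ k) a \<noteq> a"
    and "f \<in> trig_polys" "g \<in> trig_polys"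
  shows "\<forall>\<^sub>F n in sequentially.
    (LINT \<xi>|\<omega>. f \<xi> * g (\<xi> \<circ> \<beta> ^^ n)) = integral\<^sup>L \<omega> f * integral\<^sup>L \<omega> g"
proof -
  have add_pow: "Modules.additive (\<beta> ^^ n)" for n
    by (rule additive_funpow[OF \<beta>(1)])
  have int: "integrable \<omega> (\<lambda>\<xi>. f \<xi> * g (\<xi> \<circ> \<beta> ^^ n))" if "f \<in> trig_polys" "g \<in> trig_polys" for f g n
    by (rule trig_poly_integrable[OF trig_polys_mult[OF that(1) trig_polys_comp[OF that(2) add_pow[of n]]]]) simp
  have monom_integral: "(LINT \<xi>|\<omega>. Re (c * \<xi> a)) = (if a = 0 then Re c else 0)" for c a
    using sep[of a] by (subst integral_monom) (auto simp: character_0)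
  have monom_monom: "\<forall>\<^sub>F n in sequentially.
      (LINT \<xi>|\<omega>. f \<xi> * g (\<xi> \<circ> \<beta> ^^ n)) = integral\<^sup>L \<omega> f * integral\<^sup>L \<omega> g"
    if f: "\<And>\<xi>. \<xi> \<in> characters \<Longrightarrow> f \<xi> = Re (c * \<xi> a)"
      and g: "\<And>\<xi>. \<xi> \<in> characters \<Longrightarrow> g \<xi> = Re (d * \<xi> b)" for f g c d and a b :: 'a
  proof -
    have fi: "integral\<^sup>L \<omega> f = (if a = 0 then Re c else 0)"
      unfolding monom_integral[symmetric] by (intro Bochner_Integration.integral_cong) (simp_all add: f)
    have gi: "integral\<^sup>L \<omega> g = (if b = 0 then Re d else 0)"
      unfolding monom_integral[symmetric] by (intro Bochner_Integration.integral_cong) (simp_all add: g)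
    have fg: "(LINT \<xi>|\<omega>. f \<xi> * g (\<xi> \<circ> \<beta> ^^ n))
        = (if a + (\<beta> ^^ n) b = 0 then Re (c * d / 2) else 0) + (if a - (\<beta> ^^ n) b = 0 then Re (c * cnj d / 2) else 0)"
      for n
    proof -
      have Re_mult: "Re z * Re w = Re (z * w) / 2 + Re (z * cnj w) / 2" for z w
        by (simp add: field_simps)
      have Re_half: "Re (2 * z) / 2 = Re z" for z by simp
      have "f \<xi> * g (\<xi> \<circ> \<beta> ^^ n) = Re (c * d / 2 * \<xi> (a + (\<beta> ^^ n) b)) + Re (c * cnj d / 2 * \<xi> (a - (\<beta> ^^ n) b))"
        if \<xi>: "\<xi> \<in> characters" for \<xi>
      proof -
        have "f \<xi> * g (\<xi> \<circ> \<beta> ^^ n) = Re (c * \<xi> a) * Re (d * \<xi> ((\<beta> ^^ n) b))"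
          by (simp only: f[OF \<xi>] g[OF character_comp[OF \<xi> add_pow]] comp_apply)
        also have "\<dots> = Re (c * \<xi> a * (d * \<xi> ((\<beta> ^^ n) b))) / 2 + Re (c * \<xi> a * cnj (d * \<xi> ((\<beta> ^^ n) b))) / 2"
          by (rule Re_mult)
        also have "c * \<xi> a * (d * \<xi> ((\<beta> ^^ n) b)) = 2 * (c * d / 2 * \<xi> (a + (\<beta> ^^ n) b))"
          by (simp add: character_add \<xi>)
        also have "c * \<xi> a * cnj (d * \<xi> ((\<beta> ^^ n) b)) = 2 * (c * cnj d / 2 * \<xi> (a - (\<beta> ^^ n) b))"
          by (simp add: character_diff \<xi>)
        finally show ?thesis by (simp only: Re_half)
      qed
      then have "(LINT \<xi>|\<omega>. f \<xi> * g (\<xi> \<circ> \<beta> ^^ n))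
          = (LINT \<xi>|\<omega>. Re (c * d / 2 * \<xi> (a + (\<beta> ^^ n) b))) + (LINT \<xi>|\<omega>. Re (c * cnj d / 2 * \<xi> (a - (\<beta> ^^ n) b)))"
        by (intro trig_poly_integral_add trig_polys.monom[OF refl]) simp
      then show ?thesis by (simp only: monom_integral)
    qed
    show ?thesis
    proof (cases "b = 0")
      case True
      \<comment> \<open>For a = b = 0 both frequencies vanish, and the two halves must recombine to
        the product of the integrals.\<close>
      have "Re (c * d / 2) + Re (c * cnj d / 2) = Re c * Re d"
        by (simp add: field_simps)
      then show ?thesis
        using additive.zero[OF add_pow] by (auto simp: fi gi fg True simp del: Re_divide_numeral)
    next
      case False
      have inj: "inj (\<lambda>n. (\<beta> ^^ n) b)"
      proof (rule linorder_injI)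
        fix m n :: nat assume "m < n"
        show "(\<beta> ^^ m) b \<noteq> (\<beta> ^^ n) b"
        proof
          assume "(\<beta> ^^ m) b = (\<beta> ^^ n) b"
          also have "\<dots> = (\<beta> ^^ m) ((\<beta> ^^ (n - m)) b)"
            using \<open>m < n\<close> by (simp add: funpow_add[symmetric, THEN fun_cong, unfolded comp_apply])
          finally have "b = (\<beta> ^^ (n - m)) b"
            using inj_fn[OF \<beta>(2)] by (auto dest: injD)
          then show False using aperiodic[OF False, of "n - m"] \<open>m < n\<close> by simp
        qed
      qed
      \<comment> \<open>Aperiodicity makes the orbit of b injective in n, so it meets a or -a only
        finitely often.\<close>
      have "finite ((\<lambda>n. (\<beta> ^^ n) b) -` {a, - a})"
        by (intro finite_vimageI inj) simp
      then have "\<forall>\<^sub>F n in sequentially. n \<notin> (\<lambda>n. (\<beta> ^^ n) b) -` {a, - a}"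
        by (simp only: cofinite_eq_sequentially[symmetric] eventually_cofinite not_not Collect_mem_eq)
      then show ?thesis
      proof eventually_elim
        case (elim n)
        then have "a + (\<beta> ^^ n) b \<noteq> 0" "a - (\<beta> ^^ n) b \<noteq> 0"
          by (auto simp: add_eq_0_iff)
        then show ?case using False by (simp add: fg gi)
      qed
    qed
  qed
  have monom_any: "\<forall>\<^sub>F n in sequentially.
      (LINT \<xi>|\<omega>. f \<xi> * g (\<xi> \<circ> \<beta> ^^ n)) = integral\<^sup>L \<omega> f * integral\<^sup>L \<omega> g"
    if f: "\<And>\<xi>. \<xi> \<in> characters \<Longrightarrow> f \<xi> = Re (c * \<xi> a)" and "g \<in> trig_polys" for f g c a
    using that(2)
  proof induction
    case (monom g d b)
    show ?case by (rule monom_monom[OF f monom])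
  next
    case (add g1 g2 g)
    have ft: "f \<in> trig_polys" by (rule trig_polys.monom[OF f])
    from add.IH show ?case
    proof eventually_elim
      case (elim n)
      have "(LINT \<xi>|\<omega>. f \<xi> * g (\<xi> \<circ> \<beta> ^^ n)) = (LINT \<xi>|\<omega>. f \<xi> * g1 (\<xi> \<circ> \<beta> ^^ n) + f \<xi> * g2 (\<xi> \<circ> \<beta> ^^ n))"
        by (intro Bochner_Integration.integral_cong)
          (simp_all only: space_haar add.hyps(3)[OF character_comp[OF _ add_pow]] distrib_left)
      also have "\<dots> = (LINT \<xi>|\<omega>. f \<xi> * g1 (\<xi> \<circ> \<beta> ^^ n)) + (LINT \<xi>|\<omega>. f \<xi> * g2 (\<xi> \<circ> \<beta> ^^ n))"
        by (intro Bochner_Integration.integral_add int ft add.hyps)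
      finally show ?case
        by (simp only: elim trig_poly_integral_add[OF add.hyps] distrib_left)
    qed
  qed
  show ?thesis
    using assms(5)
  proof induction
    case (monom f c a)
    show ?case by (rule monom_any[OF monom assms(6)])
  next
    case (add f1 f2 f)
    from add.IH show ?case
    proof eventually_elim
      case (elim n)
      have "(LINT \<xi>|\<omega>. f \<xi> * g (\<xi> \<circ> \<beta> ^^ n)) = (LINT \<xi>|\<omega>. f1 \<xi> * g (\<xi> \<circ> \<beta> ^^ n) + f2 \<xi> * g (\<xi> \<circ> \<beta> ^^ n))"
        by (intro Bochner_Integration.integral_cong) (simp_all only: space_haar add.hyps(3) distrib_right)
      also have "\<dots> = (LINT \<xi>|\<omega>. f1 \<xi> * g (\<xi> \<circ> \<beta> ^^ n)) + (LINT \<xi>|\<omega>. f2 \<xi> * g (\<xi> \<circ> \<beta> ^^ n))"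
        by (intro Bochner_Integration.integral_add int assms add.hyps)
      finally show ?case
        by (simp only: elim trig_poly_integral_add[OF add.hyps] distrib_right)
    qed
  qed
qed

text \<open>Mixing applied to a set that is carried to itself: the correlation of A with its
  translate is both c and, up to approximation, the square of c, so c is 0 or 1. Replacing the two
  indicator factors costs 2 e, and comparing squares costs another 2 e.\<close>

lemma measure_invariant_set:
  assumes sep: "\<And>a :: 'a. a \<noteq> 0 \<Longrightarrow> \<exists>\<psi>\<in>characters. \<psi> a \<noteq> 1"
    and \<beta>: "Modules.additive \<beta>" "bij \<beta>"
    and aperiodic: "\<And>a k. a \<noteq> 0 \<Longrightarrow> k > 0 \<Longrightarrow> (\<beta> ^^ k) a \<noteq> a"
    and A: "A \<in> sets \<omega>" and invariant: "\<And>\<xi>. \<xi> \<in> characters \<Longrightarrow> \<xi> \<circ> \<beta> \<in> A \<longleftrightarrow> \<xi> \<in> A"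
  shows "prob A \<in> {0, 1}"
proof -
  define c where "c = measure \<omega> A"
  have c: "0 \<le> c" "c \<le> 1" by (auto simp: c_def)
  have bound: "\<bar>c - c\<^sup>2\<bar> \<le> 4 * e" if e: "e > 0" for e :: real
  proof -
    obtain f where f: "f \<in> trig_polys" "f ` characters \<subseteq> {0..1}"
      and approx: "(LINT \<xi>|\<omega>. \<bar>indicator A \<xi> - f \<xi>\<bar>) \<le> e"
      using ex_trig_poly_approx[OF dual_haar_axioms dual_haar_axioms A e] by auto
    obtain n where n: "(LINT \<xi>|\<omega>. f \<xi> * f (\<xi> \<circ> \<beta> ^^ n)) = integral\<^sup>L \<omega> f * integral\<^sup>L \<omega> f"
      using trig_polys_mixing[OF sep \<beta>(1) bij_is_inj[OF \<beta>(2)] aperiodic f(1) f(1)]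
      by (auto simp: eventually_sequentially)
    have add: "Modules.additive (\<beta> ^^ n)" by (rule additive_funpow[OF \<beta>(1)])
    have inv: "\<xi> \<circ> \<beta> ^^ n \<in> A \<longleftrightarrow> \<xi> \<in> A" if "\<xi> \<in> characters" for \<xi>
    proof (induction n)
      case (Suc n)
      have "\<xi> \<circ> \<beta> ^^ Suc n = (\<xi> \<circ> \<beta> ^^ n) \<circ> \<beta>"
        by (simp add: funpow_Suc_right comp_assoc del: funpow.simps)
      then show ?case
        using Suc invariant[OF character_comp[OF that additive_funpow[OF \<beta>(1)]]] by metis
    qed simp
    have cont: "continuous_on characters (\<lambda>\<xi>. \<xi> \<circ> \<beta> ^^ n)"
      unfolding comp_def by (intro continuous_on_coordinatewise_then_product continuous_on_eval)
    have meas: "(\<lambda>\<xi>. \<xi> \<circ> \<beta> ^^ n) \<in> measurable \<omega> \<omega>"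
      by (rule continuous_self_map_measurable[OF cont]) (auto intro: character_comp add)
    let ?h = "\<lambda>\<xi>. \<bar>indicator A \<xi> - f \<xi>\<bar> :: real"
    have indA: "integrable \<omega> (indicator A :: _ \<Rightarrow> real)"
      using A by (intro integrable_real_indicator) (auto simp: emeasure_eq_measure)
    have int: "integrable \<omega> ?h"
      by (intro integrable_abs Bochner_Integration.integrable_diff indA trig_poly_integrable f)
    have distr: "distr \<omega> \<omega> (\<lambda>\<xi>. \<xi> \<circ> \<beta> ^^ n) = \<omega>"
      by (rule distr_comp[OF add bij_betw_funpow[OF \<beta>(2)]])
    have int': "integrable \<omega> (\<lambda>\<xi>. ?h (\<xi> \<circ> \<beta> ^^ n))"
      by (rule integrable_distr[OF meas]) (simp only: distr int)
    have h': "(LINT \<xi>|\<omega>. ?h (\<xi> \<circ> \<beta> ^^ n)) = (LINT \<xi>|\<omega>. ?h \<xi>)"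
      using integral_distr[OF meas, of ?h] int by (simp only: distr borel_measurable_integrable)
    let ?p = "\<lambda>\<xi>. f \<xi> * f (\<xi> \<circ> \<beta> ^^ n)"
    have p: "?p \<in> trig_polys"
      by (rule trig_polys_mult[OF f(1) trig_polys_comp[OF f(1) add]]) (rule refl)
    \<comment> \<open>Invariance turns the indicator of A at \<xi> into its product with the
      indicator at \<open>\<xi> \<circ> \<beta> ^^ n\<close>; the two factors are then compared with
      those of \<open>?p\<close> one after the other.\<close>
    have ptwise: "\<bar>indicator A \<xi> - ?p \<xi>\<bar> \<le> ?h \<xi> + ?h (\<xi> \<circ> \<beta> ^^ n)" if \<xi>: "\<xi> \<in> characters" for \<xi>
    proof -
      have 1: "f \<xi> \<in> {0..1}" "f (\<xi> \<circ> \<beta> ^^ n) \<in> {0..1}"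
        using f(2) \<xi> character_comp[OF \<xi> add] by blast+
      have "\<bar>x * x' - y * y'\<bar> \<le> \<bar>x - y\<bar> + \<bar>x' - y'\<bar>" if "x' \<in> {0..1}" "y \<in> {0..1}" for x x' y y' :: real
      proof -
        have "x * x' - y * y' = (x - y) * x' + y * (x' - y')" by (simp add: algebra_simps)
        then have "\<bar>x * x' - y * y'\<bar> \<le> \<bar>x - y\<bar> * \<bar>x'\<bar> + \<bar>y\<bar> * \<bar>x' - y'\<bar>"
          by (metis abs_mult abs_triangle_ineq)
        also have "\<dots> \<le> \<bar>x - y\<bar> * 1 + 1 * \<bar>x' - y'\<bar>"
          using that by (intro add_mono mult_left_mono mult_right_mono) auto
        finally show ?thesis by simp
      qed
      from this[OF _ 1(1), of "indicator A (\<xi> \<circ> \<beta> ^^ n)" "indicator A \<xi>" "f (\<xi> \<circ> \<beta> ^^ n)"]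
      show ?thesis using inv[OF \<xi>] by (auto simp: indicator_def split: if_splits)
    qed
    have "\<bar>c - integral\<^sup>L \<omega> ?p\<bar> \<le> (LINT \<xi>|\<omega>. \<bar>indicator A \<xi> - ?p \<xi>\<bar>)"
      unfolding c_def by (rule abs_measure_diff_integral_le[OF A p])
    also have "\<dots> \<le> (LINT \<xi>|\<omega>. ?h \<xi> + ?h (\<xi> \<circ> \<beta> ^^ n))"
      by (intro integral_mono Bochner_Integration.integrable_add int int' integrable_abs
          Bochner_Integration.integrable_diff indA trig_poly_integrable[OF p])
        (rule ptwise, simp)
    also have "\<dots> \<le> e + e"
      using approx by (simp only: Bochner_Integration.integral_add[OF int int'] h')
    finally have 1: "\<bar>c - (integral\<^sup>L \<omega> f)\<^sup>2\<bar> \<le> 2 * e"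
      by (simp add: n power2_eq_square)
    have 2: "\<bar>c - integral\<^sup>L \<omega> f\<bar> \<le> e"
      using abs_measure_diff_integral_le[OF A f(1)] approx unfolding c_def by linarith
    have fi: "0 \<le> integral\<^sup>L \<omega> f" "integral\<^sup>L \<omega> f \<le> 1"
    proof -
      have f01: "0 \<le> f \<xi> \<and> f \<xi> \<le> 1" if "\<xi> \<in> space \<omega>" for \<xi>
        using f(2) that by (auto simp: image_subset_iff)
      then show "0 \<le> integral\<^sup>L \<omega> f" by (intro Bochner_Integration.integral_nonneg_AE AE_I2) auto
      have "integral\<^sup>L \<omega> f \<le> (LINT \<xi>|\<omega>. 1)"
        using f01 by (intro integral_mono trig_poly_integrable[OF f(1)]) auto
      then show "integral\<^sup>L \<omega> f \<le> 1" using prob_space by simp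
    qed
    have "(integral\<^sup>L \<omega> f)\<^sup>2 - c\<^sup>2 = (integral\<^sup>L \<omega> f - c) * (integral\<^sup>L \<omega> f + c)"
      by (simp add: algebra_simps power2_eq_square)
    then have "\<bar>(integral\<^sup>L \<omega> f)\<^sup>2 - c\<^sup>2\<bar> = \<bar>c - integral\<^sup>L \<omega> f\<bar> * \<bar>integral\<^sup>L \<omega> f + c\<bar>"
      by (simp add: abs_mult abs_minus_commute)
    also have "\<dots> \<le> e * 2"
      using 2 fi c e by (intro mult_mono) auto
    finally show ?thesis using 1 by linarith
  qed
  have "c - c\<^sup>2 = 0"
  proof (rule ccontr)
    assume "c - c\<^sup>2 \<noteq> 0"
    \<comment> \<open>With this e the bound is half of the positive number it is supposed to
      dominate.\<close>
    then show False using bound[of "\<bar>c - c\<^sup>2\<bar> / 8"] by simp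
  qed
  then have "c * (1 - c) = 0" by (simp add: algebra_simps power2_eq_square)
  then show ?thesis by (auto simp: c_def)
qed

text \<open>Open sets around the trivial character have positive measure, hence measure 1.
  Intersecting countably many of them gives \<open>\<xi> v = 1\<close> almost everywhere, so
  evaluation at v has integral 1, whereas a nontrivial value at v would force 0.\<close>

lemma annihilated_if_zero_one_neighbourhoods:
  assumes Z: "finite Z" "v \<in> Z"
    and zero_one: "\<And>e. e > 0 \<Longrightarrow> prob {\<xi> \<in> characters. \<forall>b\<in>Z. cmod (\<xi> b - 1) < e} \<in> {0, 1}"
    and \<psi>: "\<psi> \<in> characters"
  shows "\<psi> v = 1"
proof (rule ccontr)
  assume "\<psi> v \<noteq> 1"
  define N where "N e = {\<xi> \<in> characters. \<forall>b\<in>Z. cmod (\<xi> b - 1) < e}" for e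
  have "AE \<xi> in \<omega>. \<xi> \<in> N e" if "e > 0" for e
  proof -
    have op: "openin (top_of_set characters) (N e)"
      unfolding N_def by (rule openin_neighbourhood_one[OF Z(1)])
    moreover have "(\<lambda>_. 1) \<in> N e"
      using that character_one by (auto simp: N_def)
    ultimately have "prob (N e) > 0" by (intro measure_open_pos) auto
    then have "prob (N e) = 1" using zero_one[OF that] by (auto simp: N_def)
    then show ?thesis using open_in_sets[OF op] by (simp add: prob_eq_1)
  qed
  then have "AE \<xi> in \<omega>. \<forall>n. \<xi> \<in> N (inverse (Suc n))"
    by (simp add: AE_all_countable)
  then have "AE \<xi> in \<omega>. \<xi> v = 1"
  proof eventually_elim
    case (elim \<xi>)
    show ?case
    proof (rule ccontr)
      assume "\<xi> v \<noteq> 1"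
      then obtain n where "inverse (real (Suc n)) < cmod (\<xi> v - 1)"
        using reals_Archimedean[of "cmod (\<xi> v - 1)"] by auto
      moreover have "cmod (\<xi> v - 1) < inverse (Suc n)"
        using elim Z(2) by (auto simp: N_def)
      ultimately show False by simp
    qed
  qed
  then have "(LINT \<xi>|\<omega>. \<xi> v) = (LINT \<xi>|\<omega>. 1)"
    by (intro integral_cong_AE continuous_imp_measurable continuous_on_eval) auto
  then show False
    using integral_character[OF \<psi> \<open>\<psi> v \<noteq> 1\<close>] prob_space by simp
qed

end

section \<open>Dual automorphisms\<close>

lemma dual_automorphism_apply:
  "\<xi> \<in> characters \<Longrightarrow> dual_automorphism \<alpha> \<xi> = \<xi> \<circ> inv_into UNIV \<alpha>"
  by (simp add: dual_automorphism_def)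

lemma dual_automorphism_in_characters:
  assumes "\<alpha> \<in> linear_automorphisms" "\<xi> \<in> characters"
  shows "dual_automorphism \<alpha> \<xi> \<in> characters"
  using character_comp[OF assms(2) linear_automorphism_additive[OF linear_automorphism_inv[OF assms(1)]]]
  by (simp add: dual_automorphism_apply assms(2))

lemma linear_automorphism_bij: "\<alpha> \<in> linear_automorphisms \<Longrightarrow> bij \<alpha>"
  by (simp add: linear_automorphisms_def)

lemma linear_automorphism_inverse:
  assumes "\<alpha> \<in> linear_automorphisms"
  shows "\<alpha> (inv_into UNIV \<alpha> v) = v" "inv_into UNIV \<alpha> (\<alpha> v) = v"
  using linear_automorphism_bij[OF assms] by (auto simp: bij_is_inj bij_is_surj surj_f_inv_f)

text \<open>The inverse in the definition of the dual makes duality preserve the order of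
  composition.\<close>

lemma dual_automorphism_comp:
  assumes "\<alpha> \<in> linear_automorphisms" "\<beta> \<in> linear_automorphisms" "\<xi> \<in> characters"
  shows "dual_automorphism \<alpha> (dual_automorphism \<beta> \<xi>) = dual_automorphism (\<alpha> \<circ> \<beta>) \<xi>"
  using dual_automorphism_in_characters[OF assms(2,3)] assms
  by (simp add: dual_automorphism_apply comp_assoc o_inv_distrib linear_automorphism_bij)

lemma dual_automorphism_id: "\<xi> \<in> characters \<Longrightarrow> dual_automorphism id \<xi> = \<xi>"
  by (simp add: dual_automorphism_apply)

lemma dual_automorphism_inv_cancel:
  assumes "\<alpha> \<in> linear_automorphisms" "\<xi> \<in> characters"
  shows "dual_automorphism \<alpha> (dual_automorphism (inv_into UNIV \<alpha>) \<xi>) = \<xi>"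
    "dual_automorphism (inv_into UNIV \<alpha>) (dual_automorphism \<alpha> \<xi>) = \<xi>"
proof -
  have "\<alpha> \<circ> inv_into UNIV \<alpha> = id" "inv_into UNIV \<alpha> \<circ> \<alpha> = id"
    by (auto simp: linear_automorphism_inverse[OF assms(1)])
  then show "dual_automorphism \<alpha> (dual_automorphism (inv_into UNIV \<alpha>) \<xi>) = \<xi>"
    "dual_automorphism (inv_into UNIV \<alpha>) (dual_automorphism \<alpha> \<xi>) = \<xi>"
    using assms linear_automorphism_inv[OF assms(1)]
    by (simp_all add: dual_automorphism_comp dual_automorphism_id)
qed

lemma dual_automorphism_in_auto:
  assumes "\<alpha> \<in> linear_automorphisms"
  shows "dual_automorphism \<alpha> \<in> auto dual_group"
proof -
  have "bij_betw (dual_automorphism \<alpha>) characters characters"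
    by (rule bij_betw_byWitness[where f' = "dual_automorphism (inv_into UNIV \<alpha>)"])
      (auto simp: dual_automorphism_inv_cancel assms dual_automorphism_in_characters linear_automorphism_inv)
  moreover have "dual_automorphism \<alpha> \<in> hom dual_group dual_group"
  proof (rule homI)
    show "dual_automorphism \<alpha> (\<xi> \<otimes>\<^bsub>dual_group\<^esub> \<psi>)
        = dual_automorphism \<alpha> \<xi> \<otimes>\<^bsub>dual_group\<^esub> dual_automorphism \<alpha> \<psi>"
      if "\<xi> \<in> characters" "\<psi> \<in> characters" for \<xi> \<psi>
      using that by (simp add: mult_dual_group dual_automorphism_apply character_mult fun_eq_iff)
  qed (rule dual_automorphism_in_characters[OF assms])
  moreover have "dual_automorphism \<alpha> \<in> extensional characters"
    by (simp add: dual_automorphism_def)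
  ultimately show ?thesis
    by (simp add: auto_def Bij_def)
qed

lemma carrier_dual_linear [simp]:
  "carrier dual_linear_automorphism_group = dual_automorphism ` linear_automorphisms"
  by (simp add: dual_linear_automorphism_group_def)

lemma mult_dual_linear:
  assumes "\<alpha> \<in> linear_automorphisms" "\<beta> \<in> linear_automorphisms"
  shows "dual_automorphism \<alpha> \<otimes>\<^bsub>dual_linear_automorphism_group\<^esub> dual_automorphism \<beta>
    = dual_automorphism (\<alpha> \<circ> \<beta>)"
proof -
  \<comment> \<open>Multiplication in \<open>BijGroup\<close> is composition only between members of
    \<open>Bij\<close>.\<close>
  have "dual_automorphism \<alpha> \<in> Bij characters" "dual_automorphism \<beta> \<in> Bij characters"
    using dual_automorphism_in_auto[OF assms(1)] dual_automorphism_in_auto[OF assms(2)]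
    by (auto simp: auto_def)
  then have "dual_automorphism \<alpha> \<otimes>\<^bsub>dual_linear_automorphism_group\<^esub> dual_automorphism \<beta>
      = compose characters (dual_automorphism \<alpha>) (dual_automorphism \<beta>)"
    by (simp add: dual_linear_automorphism_group_def AutoGroup_def BijGroup_def)
  also have "\<dots> = dual_automorphism (\<alpha> \<circ> \<beta>)"
  proof
    fix \<xi>
    show "compose characters (dual_automorphism \<alpha>) (dual_automorphism \<beta>) \<xi> = dual_automorphism (\<alpha> \<circ> \<beta>) \<xi>"
      using dual_automorphism_comp[OF assms]
      by (cases "\<xi> \<in> characters") (simp_all add: compose_def, simp add: dual_automorphism_def)
  qed
  finally show ?thesis .
qed

lemma one_dual_linear: "\<one>\<^bsub>dual_linear_automorphism_group\<^esub> = dual_automorphism id"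
  by (auto simp: dual_linear_automorphism_group_def AutoGroup_def BijGroup_def dual_automorphism_def
      fun_eq_iff)

lemma group_dual_linear: "group dual_linear_automorphism_group"
proof (rule groupI)
  fix x assume "x \<in> carrier dual_linear_automorphism_group"
  then obtain \<alpha> where \<alpha>: "\<alpha> \<in> linear_automorphisms" "x = dual_automorphism \<alpha>" by auto
  have "inv_into UNIV \<alpha> \<circ> \<alpha> = id"
    by (auto simp: linear_automorphism_inverse[OF \<alpha>(1)])
  then show "\<exists>y\<in>carrier dual_linear_automorphism_group.
      y \<otimes>\<^bsub>dual_linear_automorphism_group\<^esub> x = \<one>\<^bsub>dual_linear_automorphism_group\<^esub>"
    using linear_automorphism_inv[OF \<alpha>(1)]
    by (auto simp: \<alpha> one_dual_linear mult_dual_linear intro!: bexI[of _ "inv_into UNIV \<alpha>"])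
qed (auto simp: mult_dual_linear one_dual_linear linear_automorphism_comp linear_automorphism_id comp_assoc)

lemma inv_dual_linear:
  assumes "\<alpha> \<in> linear_automorphisms"
  shows "inv\<^bsub>dual_linear_automorphism_group\<^esub> dual_automorphism \<alpha> = dual_automorphism (inv_into UNIV \<alpha>)"
proof (rule group.inv_equality[OF group_dual_linear])
  have "inv_into UNIV \<alpha> \<circ> \<alpha> = id"
    by (auto simp: linear_automorphism_inverse[OF assms])
  then show "dual_automorphism (inv_into UNIV \<alpha>) \<otimes>\<^bsub>dual_linear_automorphism_group\<^esub> dual_automorphism \<alpha>
      = \<one>\<^bsub>dual_linear_automorphism_group\<^esub>"
    by (simp add: mult_dual_linear assms linear_automorphism_inv one_dual_linear)
qed (auto simp: assms linear_automorphism_inv)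

text \<open>Transfers commutativity from a group of dual automorphisms back to the linear
  maps.\<close>

lemma dual_automorphism_inject:
  fixes \<alpha> \<beta> :: "'f :: field ^ 'n \<Rightarrow> 'f ^ 'n"
  assumes sep: "\<And>a :: 'f ^ 'n. a \<noteq> 0 \<Longrightarrow> \<exists>\<psi>\<in>characters. \<psi> a \<noteq> 1"
    and "\<alpha> \<in> linear_automorphisms" "\<beta> \<in> linear_automorphisms"
    and eq: "dual_automorphism \<alpha> = dual_automorphism \<beta>"
  shows "\<alpha> = \<beta>"
proof -
  have "inv_into UNIV \<alpha> v = inv_into UNIV \<beta> v" for v
  proof (rule ccontr)
    assume "inv_into UNIV \<alpha> v \<noteq> inv_into UNIV \<beta> v"
    then obtain \<psi> where \<psi>: "\<psi> \<in> characters" "\<psi> (inv_into UNIV \<alpha> v - inv_into UNIV \<beta> v) \<noteq> 1"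
      using sep[of "inv_into UNIV \<alpha> v - inv_into UNIV \<beta> v"] by auto
    have "\<psi> (inv_into UNIV \<alpha> v) = \<psi> (inv_into UNIV \<beta> v)"
      using dual_automorphism_apply[OF \<psi>(1), of \<alpha>] dual_automorphism_apply[OF \<psi>(1), of \<beta>] eq
      by (metis comp_apply)
    then show False
      using \<psi> cnj_mult_character[OF \<psi>(1)] by (simp add: character_diff mult.commute)
  qed
  then show ?thesis
    using assms(2,3) by (metis ext linear_automorphism_inverse)
qed

section \<open>The descending chain condition\<close>

lemma linear_automorphism_scalar:
  assumes "c \<noteq> 0"
  shows "(*s) c \<in> linear_automorphisms" "inv_into UNIV ((*s) (inverse c)) = (*s) c"
proof -
  have "bij ((*s) c)"
    by (rule bij_betw_byWitness[where f' = "(*s) (inverse c)"]) (auto simp: assms)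
  then show "(*s) c \<in> linear_automorphisms"
    by (auto simp: linear_automorphisms_def Vector_Spaces.linear_iff vec.vector_space_axioms
        vec.scale_right_distrib mult.commute)
  show "inv_into UNIV ((*s) (inverse c)) = (*s) c"
    by (rule inv_equality) (auto simp: assms)
qed

lemma scalar_in_center:
  assumes "c \<noteq> 0"
  shows "dual_automorphism ((*s) c) \<in> group_center dual_linear_automorphism_group"
proof -
  have "(*s) c \<circ> \<beta> = \<beta> \<circ> (*s) c" if "\<beta> \<in> linear_automorphisms" for \<beta>
    using linear_automorphism_scale[OF that] by (auto simp: fun_eq_iff)
  from arg_cong[OF this] have "dual_automorphism ((*s) c \<circ> \<beta>) = dual_automorphism (\<beta> \<circ> (*s) c)"
    if "\<beta> \<in> linear_automorphisms" for \<beta>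
    using that .
  then show ?thesis
    using linear_automorphism_scalar(1)[OF assms] by (auto simp: group_center_def mult_dual_linear)
qed

lemma subspace_annihilator:
  fixes L :: "('f :: field ^ 'n \<Rightarrow> complex) set"
  assumes L: "L \<subseteq> characters" "invariant_under (group_center dual_linear_automorphism_group) L"
  shows "vec.subspace {a. \<forall>\<xi>\<in>L. \<xi> a = 1}"
proof (rule vec.subspaceI)
  fix c a assume a: "a \<in> {a. \<forall>\<xi>\<in>L. \<xi> a = 1}"
  have "\<xi> (c *s a) = 1" if \<xi>: "\<xi> \<in> L" for \<xi>
  proof (cases "c = 0")
    case True
    then show ?thesis using L \<xi> character_0[of \<xi>] by auto
  next
    case False
    \<comment> \<open>Duals involve inverses, so precomposition with scaling by c is the dual of
      scaling by the inverse of c.\<close>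
    then have "dual_automorphism ((*s) (inverse c)) ` L = L"
      using L(2) scalar_in_center[of "inverse c"] by (auto simp: invariant_under_def)
    then have "dual_automorphism ((*s) (inverse c)) \<xi> \<in> L" using \<xi> by blast
    moreover have "dual_automorphism ((*s) (inverse c)) \<xi> = \<xi> \<circ> (*s) c"
      using L \<xi> by (auto simp: dual_automorphism_apply linear_automorphism_scalar(2)[OF False])
    ultimately show ?thesis using a by auto
  qed
  then show "c *s a \<in> {a. \<forall>\<xi>\<in>L. \<xi> a = 1}" by simp
qed (use L in \<open>auto simp: subset_iff character_add character_0\<close>)

lemma has_DCC_center:
  "has_DCC (dual_group :: ('f :: field ^ 'n \<Rightarrow> complex) monoid) dual_topology
    (group_center dual_linear_automorphism_group)"
  unfolding has_DCC_def
proof (intro allI impI, elim conjE)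
  fix L :: "nat \<Rightarrow> ('f ^ 'n \<Rightarrow> complex) set"
  assume dec: "decseq L" and "\<forall>i. subgroup (L i) dual_group \<and> closedin dual_topology (L i) \<and>
    invariant_under (group_center dual_linear_automorphism_group) (L i)"
  then have L: "subgroup (L i) dual_group" "closedin dual_topology (L i)"
    "invariant_under (group_center dual_linear_automorphism_group) (L i)" for i
    by auto
  define B where "B i = {a. \<forall>\<xi>\<in>L i. \<xi> a = 1}" for i
  have sub: "vec.subspace (B i)" for i
    unfolding B_def by (intro subspace_annihilator L subgroup.subset)
  \<comment> \<open>Annihilators grow along the chain and their dimensions are bounded, so one of
    maximal dimension equals all later ones.\<close>
  obtain n where n: "\<And>i. vec.dim (B i) \<le> vec.dim (B n)"
    using ex_has_greatest_nat[of "\<lambda>_. True" 0 "\<lambda>i. vec.dim (B i)" "Suc (vec.dim (UNIV :: ('f ^ 'n) set))"]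
      vec.dim_subset[OF subset_UNIV]
    by (metis less_Suc_eq_le)
  have "L n \<subseteq> L (n + i)" for i
  proof
    fix \<xi> assume \<xi>: "\<xi> \<in> L n"
    have "L (n + i) \<subseteq> L n" using dec by (simp add: decseq_def)
    then have "B n \<subseteq> B (n + i)" by (auto simp: B_def)
    then have "B n = B (n + i)"
      by (intro vec.subspace_dim_equal sub n)
    then show "\<xi> \<in> L (n + i)"
      using \<xi> subsetD[OF subgroup.subset[OF L(1)] \<xi>]
      by (intro closed_subgroup_annihilator[OF L(1,2)]) (auto simp: B_def)
  qed
  then show "\<exists>n. \<forall>i. L n = L (n + i)"
    using decseqD[OF dec, of n] by (intro exI[of _ n] allI equalityI) simp_all
qed

section \<open>Ergodic automorphisms\<close>

text \<open>The linear group is transitive on the nonzero vectors, so one nontrivial character suffices.\<close>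

lemma characters_separate:
  fixes a b :: "'f :: field ^ 'n"
  assumes "\<psi> \<in> characters" "\<psi> b \<noteq> 1" "a \<noteq> 0"
  shows "\<exists>\<xi>\<in>characters. \<xi> a \<noteq> 1"
proof -
  obtain i where i: "a $ i \<noteq> 0" using assms(3) by (auto simp: vec_eq_iff)
  let ?g = "\<lambda>x :: 'f ^ 'n. (x $ i / a $ i) *s b"
  have "Modules.additive ?g"
    by (simp add: Modules.additive_def add_divide_distrib vec.scale_left_distrib)
  then have "\<psi> \<circ> ?g \<in> characters" by (rule character_comp[OF assms(1)])
  moreover have "(\<psi> \<circ> ?g) a \<noteq> 1" using i assms(2) by simp
  ultimately show ?thesis by blast
qed

text \<open>The dual acts by composition with the inverse of \<alpha>, so the zero-one law is
  applied to the inverse, which inherits aperiodicity.\<close>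

lemma ergodic_automorphism_dual:
  fixes \<omega> :: "('f :: field ^ 'n \<Rightarrow> complex) measure"
  assumes haar: "normalized_haar_measure dual_group dual_topology \<omega>"
    and sep: "\<And>a :: 'f ^ 'n. a \<noteq> 0 \<Longrightarrow> \<exists>\<psi>\<in>characters. \<psi> a \<noteq> 1"
    and \<alpha>: "\<alpha> \<in> linear_automorphisms"
    and aperiodic: "\<And>a k. a \<noteq> 0 \<Longrightarrow> k > 0 \<Longrightarrow> (\<alpha> ^^ k) a \<noteq> a"
  shows "ergodic_automorphism dual_group \<omega> (dual_automorphism \<alpha>)"
  unfolding ergodic_automorphism_def ergodic_group_def
proof (intro ballI impI)
  interpret dual_haar \<omega> using haar by unfold_locales
  let ?\<beta> = "inv_into UNIV \<alpha>"
  fix A assume A: "A \<in> sets \<omega>"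
    and "invariant_under {dual_automorphism \<alpha> [^]\<^bsub>AutoGroup dual_group\<^esub> n |n::int. True} A"
  then have "(dual_automorphism \<alpha> [^]\<^bsub>AutoGroup dual_group\<^esub> (1::int)) ` A = A"
    unfolding invariant_under_def by blast
  moreover have "dual_automorphism \<alpha> \<in> carrier (AutoGroup dual_group)"
    using dual_automorphism_in_auto[OF \<alpha>] by (simp add: AutoGroup_def)
  ultimately have inv: "dual_automorphism \<alpha> ` A = A"
    using group.int_pow_1[OF group.AutoGroup[OF group_dual_group]] by metis
  have AK: "A \<subseteq> characters" using sets.sets_into_space[OF A] by simp
  have "prob A \<in> {0, 1}"
  proof (rule measure_invariant_set[OF sep _ _ _ A])
    show "Modules.additive ?\<beta>" "bij ?\<beta>"
      using linear_automorphism_inv[OF \<alpha>]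
      by (auto intro: linear_automorphism_additive linear_automorphism_bij)
    show "(?\<beta> ^^ k) a \<noteq> a" if "a \<noteq> 0" "k > 0" for a k
    proof
      assume "(?\<beta> ^^ k) a = a"
      have "\<alpha> \<circ> ?\<beta> = id" "?\<beta> \<circ> \<alpha> = id"
        by (auto simp: linear_automorphism_inverse[OF \<alpha>])
      then have "(\<alpha> ^^ k) ((?\<beta> ^^ k) a) = a"
        using funpow_comp[of \<alpha> ?\<beta> k] by (metis comp_apply id_apply id_funpow)
      then show False using \<open>(?\<beta> ^^ k) a = a\<close> aperiodic[OF that] by simp
    qed
    show "\<xi> \<circ> ?\<beta> \<in> A \<longleftrightarrow> \<xi> \<in> A" if "\<xi> \<in> characters" for \<xi>
    proof -
      have "dual_automorphism \<alpha> \<xi> \<in> A \<longleftrightarrow> \<xi> \<in> A"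
      proof
        assume "dual_automorphism \<alpha> \<xi> \<in> A"
        then obtain \<eta> where "\<eta> \<in> A" "dual_automorphism \<alpha> \<xi> = dual_automorphism \<alpha> \<eta>"
          using inv by (metis imageE)
        then show "\<xi> \<in> A"
          using dual_automorphism_inv_cancel(2)[OF \<alpha>] that AK by (metis subsetD)
      qed (use inv in blast)
      then show ?thesis by (simp add: dual_automorphism_apply that)
    qed
  qed auto
  then show "emeasure \<omega> A \<in> {0, 1}" by (auto simp: emeasure_eq_measure)
qed

text \<open>Along the derivation for s, the vector is replaced by \<open>s^k w - w\<close> as long
  as this is nonzero; the last nonzero vector is periodic for s. Since s commutes with the other
  maps, periodicity and quasi-periodicity already secured are preserved.\<close>

lemma ex_common_periodic:
  fixes R :: "('a :: ab_group_add \<Rightarrow> 'a) set"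
  assumes add: "\<And>r. r \<in> R \<Longrightarrow> Modules.additive r"
    and comm: "\<And>r s. r \<in> R \<Longrightarrow> s \<in> R \<Longrightarrow> r \<circ> s = s \<circ> r"
    and v: "v \<noteq> 0" "\<And>r. r \<in> R \<Longrightarrow> v \<in> quasi_periodic r"
    and "finite S" "S \<subseteq> R"
  shows "\<exists>w. w \<noteq> 0 \<and> (\<forall>r\<in>R. w \<in> quasi_periodic r) \<and> (\<forall>s\<in>S. \<exists>k>0. (s ^^ k) w = w)"
  using assms(5,6)
proof (induction S rule: finite_induct)
  case empty
  then show ?case using v by auto
next
  case (insert s S)
  then have s: "s \<in> R" and S: "S \<subseteq> R" by auto
  obtain w where w: "w \<noteq> 0" "\<forall>r\<in>R. w \<in> quasi_periodic r" "\<forall>t\<in>S. \<exists>k>0. (t ^^ k) w = w"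
    using insert by auto
  from w(2) s have "w \<in> quasi_periodic s" by auto
  then show ?case using w
  proof induction
    case (step k w)
    define u where "u = (s ^^ k) w - w"
    show ?case
    proof (cases "u = 0")
      case True
      then have "(s ^^ k) w = w" by (simp add: u_def)
      then show ?thesis using step.prems step.hyps(1) by (intro exI[of _ w]) auto
    next
      case False
      have "u \<in> quasi_periodic r" if "r \<in> R" for r
        unfolding u_def using that step.prems(2)
        by (intro quasi_periodic_diff_image[OF add additive_funpow[OF add] comp_funpow_commute[OF comm]] s) auto
      moreover have "\<exists>k>0. (t ^^ k) u = u" if t: "t \<in> S" for t
      proof -
        obtain j where j: "j > 0" "(t ^^ j) w = w" using step.prems(3) t by auto
        have "(t ^^ j) u = (s ^^ k) ((t ^^ j) w) - (t ^^ j) w"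
          unfolding u_def using t S s comm[of t s]
          by (simp add: additive.diff[OF additive_funpow[OF add]] subset_iff funpow_commute)
        with j show ?thesis by (auto simp: u_def)
      qed
      ultimately show ?thesis
        using step.IH[folded u_def] False by blast
    qed
  qed auto
qed

text \<open>By commutation all points of the orbit share the periods of w. Carrying this along in
  the induction lets each new map enlarge the set by finitely many powers.\<close>

lemma ex_finite_invariant:
  fixes R :: "('a \<Rightarrow> 'a) set"
  assumes comm: "\<And>r s. r \<in> R \<Longrightarrow> s \<in> R \<Longrightarrow> r \<circ> s = s \<circ> r"
    and k: "\<And>r. r \<in> R \<Longrightarrow> k r > 0 \<and> (r ^^ k r) w = w"
    and "finite S" "S \<subseteq> R"
  shows "\<exists>Z. finite Z \<and> w \<in> Z \<and> (\<forall>r\<in>R. \<forall>x\<in>Z. (r ^^ k r) x = x) \<and> (\<forall>s\<in>S. s ` Z \<subseteq> Z)"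
  using assms(3,4)
proof (induction S rule: finite_induct)
  case empty
  then show ?case using k by (intro exI[of _ "{w}"]) auto
next
  case (insert s S)
  then have s: "s \<in> R" and S: "S \<subseteq> R" by auto
  obtain Z where Z: "finite Z" "w \<in> Z" "\<forall>r\<in>R. \<forall>x\<in>Z. (r ^^ k r) x = x" "\<forall>s\<in>S. s ` Z \<subseteq> Z"
    using insert by auto
  define Y where "Y = (\<Union>j<k s. (s ^^ j) ` Z)"
  have "Z \<subseteq> Y" using k[OF s] by (force simp: Y_def)
  have comm': "(r ^^ m) ((s ^^ j) x) = (s ^^ j) ((r ^^ m) x)" if "r \<in> R" for r m j x
    by (rule funpow_commute[OF comm[OF that s]])
  have "s y \<in> Y" if y: "y \<in> Y" for y
  proof -
    obtain j x where jx: "j < k s" "x \<in> Z" "y = (s ^^ j) x" using y by (auto simp: Y_def)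
    show ?thesis
    proof (cases "Suc j < k s")
      case True
      then show ?thesis using jx by (auto simp: Y_def intro!: bexI[of _ "Suc j"])
    next
      \<comment> \<open>At the last exponent s wraps around to x, because its \<open>k s\<close>-th
        power fixes x.\<close>
      case False
      then have "Suc j = k s" using jx by simp
      then have "s y = x" using Z(3) s jx by (metis comp_apply funpow.simps(2))
      then show ?thesis using jx \<open>Z \<subseteq> Y\<close> by auto
    qed
  qed
  moreover have "t y \<in> Y" if t: "t \<in> S" and y: "y \<in> Y" for t y
  proof -
    obtain j x where jx: "j < k s" "x \<in> Z" "y = (s ^^ j) x" using y by (auto simp: Y_def)
    have "t y = (s ^^ j) (t x)" using comm'[of t 1 j x] t S jx by auto
    moreover have "t x \<in> Z" using Z(4) t jx by blast
    ultimately show ?thesis using jx(1) by (auto simp: Y_def)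
  qed
  ultimately show ?case
  proof (intro exI[of _ Y] conjI ballI)
    show "finite Y" using Z(1) by (simp add: Y_def)
    show "(r ^^ k r) x = x" if "r \<in> R" "x \<in> Y" for r x
      using that Z(3) comm'[OF that(1)] by (auto simp: Y_def)
  qed (use Z \<open>Z \<subseteq> Y\<close> in auto)
qed

text \<open>Elements of the generated group are words in generators and their inverses; equality of
  image and set, unlike inclusion, passes to inverses.\<close>

lemma generate_dual_invariant:
  fixes R :: "('f :: field ^ 'n \<Rightarrow> 'f ^ 'n) set"
  assumes sep: "\<And>a :: 'f ^ 'n. a \<noteq> 0 \<Longrightarrow> \<exists>\<psi>\<in>characters. \<psi> a \<noteq> 1"
    and R: "R \<subseteq> linear_automorphisms" "\<And>r. r \<in> R \<Longrightarrow> r ` Z = Z"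
    and "x \<in> generate dual_linear_automorphism_group (dual_automorphism ` R)"
  shows "\<exists>\<beta>\<in>linear_automorphisms. x = dual_automorphism \<beta> \<and> \<beta> ` Z = Z"
  using assms(4)
proof induction
  case one
  show ?case
    unfolding one_dual_linear
    by (intro bexI[of _ id] conjI refl linear_automorphism_id) simp
next
  case (incl h)
  then show ?case using R by blast
next
  case (inv h)
  then obtain r where r: "r \<in> R" "h = dual_automorphism r" "r \<in> linear_automorphisms"
    using R(1) by auto
  have "inv_into UNIV r ` (r ` Z) = Z"
    using linear_automorphism_inverse(2)[OF r(3)] by (auto simp: image_image)
  then show ?case
    using r R(2)[OF r(1)] linear_automorphism_inv[OF r(3)]
    by (intro bexI[of _ "inv_into UNIV r"]) (auto simp: inv_dual_linear)
next
  case (eng h1 h2)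
  then obtain \<beta> \<gamma> where \<beta>: "\<beta> \<in> linear_automorphisms" "h1 = dual_automorphism \<beta>" "\<beta> ` Z = Z"
    and \<gamma>: "\<gamma> \<in> linear_automorphisms" "h2 = dual_automorphism \<gamma>" "\<gamma> ` Z = Z"
    by auto
  have "(\<beta> \<circ> \<gamma>) ` Z = Z"
    by (simp only: image_comp[symmetric] \<beta>(3) \<gamma>(3))
  then show ?case
    unfolding \<beta>(2) \<gamma>(2) mult_dual_linear[OF \<beta>(1) \<gamma>(1)]
    using linear_automorphism_comp[OF \<beta>(1) \<gamma>(1)] by blast
qed

text \<open>The inclusion holds for \<beta> and for its inverse, and both together give
  equality.\<close>

lemma dual_automorphism_image_neighbourhood:
  assumes \<beta>: "\<beta> \<in> linear_automorphisms" "\<beta> ` Z = Z"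
  shows "dual_automorphism \<beta> ` {\<xi> \<in> characters. \<forall>b\<in>Z. cmod (\<xi> b - 1) < e}
    = {\<xi> \<in> characters. \<forall>b\<in>Z. cmod (\<xi> b - 1) < e}" (is "_ ` ?N = ?N")
proof -
  have sub: "dual_automorphism \<gamma> ` ?N \<subseteq> ?N" if "\<gamma> \<in> linear_automorphisms" "inv_into UNIV \<gamma> ` Z = Z" for \<gamma>
  proof -
    have "inv_into UNIV \<gamma> b \<in> Z" if "b \<in> Z" for b
      using that \<open>inv_into UNIV \<gamma> ` Z = Z\<close> by blast
    then show ?thesis
      using dual_automorphism_in_characters[OF that(1)] by (auto simp: dual_automorphism_apply)
  qed
  have "inv_into UNIV \<beta> ` (\<beta> ` Z) = Z"
    using linear_automorphism_inverse(2)[OF \<beta>(1)] by (auto simp: image_image)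
  then have 1: "inv_into UNIV \<beta> ` Z = Z" using \<beta>(2) by simp
  have "inv_into UNIV (inv_into UNIV \<beta>) = \<beta>"
    by (rule inv_inv_eq[OF linear_automorphism_bij[OF \<beta>(1)]])
  then have "dual_automorphism (inv_into UNIV \<beta>) ` ?N \<subseteq> ?N"
    using \<beta> linear_automorphism_inv by (intro sub) auto
  moreover have "\<xi> = dual_automorphism \<beta> (dual_automorphism (inv_into UNIV \<beta>) \<xi>)" if "\<xi> \<in> ?N" for \<xi>
    using dual_automorphism_inv_cancel(1)[OF \<beta>(1)] that by simp
  ultimately have "?N \<subseteq> dual_automorphism \<beta> ` ?N" by blast
  then show ?thesis using sub[OF \<beta>(1) 1] by blast
qed

lemma ex_ergodic_automorphism:
  fixes \<omega> :: "('f :: field ^ 'n \<Rightarrow> complex) measure"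
  assumes haar: "normalized_haar_measure dual_group dual_topology \<omega>"
    and sub: "subgroup \<Gamma> dual_linear_automorphism_group"
    and comm: "comm_group (dual_linear_automorphism_group\<lparr>carrier := \<Gamma>\<rparr>)"
    and fg: "finitely_generated_subgroup \<Gamma> dual_linear_automorphism_group"
    and ergodic: "ergodic_group \<omega> \<Gamma>"
  shows "\<exists>\<alpha>\<in>\<Gamma>. ergodic_automorphism dual_group \<omega> \<alpha>"
proof (cases "\<exists>\<psi>\<in>(characters :: ('f ^ 'n \<Rightarrow> complex) set). \<exists>b. \<psi> b \<noteq> 1")
  case False \<comment> \<open>the dual group is trivial\<close>
  interpret dual_haar \<omega> using haar by unfold_locales
  have "space \<omega> \<subseteq> {\<lambda>_. 1}" using False by auto
  then have "A = {} \<or> A = space \<omega>" if "A \<in> sets \<omega>" for A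
    using sets.sets_into_space[OF that] by auto
  then have "emeasure \<omega> A \<in> {0, 1}" if "A \<in> sets \<omega>" for A
    using that emeasure_space_1 by fastforce
  then show ?thesis
    using subgroup.one_closed[OF sub] by (auto simp: ergodic_automorphism_def ergodic_group_def)
next
  case True
  interpret dual_haar \<omega> using haar by unfold_locales
  have sep: "\<exists>\<psi>\<in>characters. \<psi> a \<noteq> 1" if "a \<noteq> 0" for a :: "'f ^ 'n"
    using True characters_separate[OF _ _ that] by auto
  \<comment> \<open>The linear maps lying over \<Gamma>: the search takes place here, where
    quasi-periodicity makes sense. Commutativity comes back from \<Gamma> because duality is
    injective.\<close>
  define T where "T = {\<alpha> \<in> linear_automorphisms. dual_automorphism \<alpha> \<in> \<Gamma>}"
  have T: "\<alpha> \<in> linear_automorphisms" "dual_automorphism \<alpha> \<in> \<Gamma>" if "\<alpha> \<in> T" for \<alpha>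
    using that by (auto simp: T_def)
  have T_comp: "\<alpha> \<circ> \<beta> \<in> T" if "\<alpha> \<in> T" "\<beta> \<in> T" for \<alpha> \<beta>
    using subgroup.m_closed[OF sub T(2)[OF that(1)] T(2)[OF that(2)]] T(1)[OF that(1)] T(1)[OF that(2)]
    by (simp add: T_def mult_dual_linear linear_automorphism_comp)
  have T_id: "id \<in> T"
    using subgroup.one_closed[OF sub] by (simp add: T_def one_dual_linear linear_automorphism_id)
  have T_pow: "\<alpha> ^^ n \<in> T" if "\<alpha> \<in> T" for \<alpha> n
    using that T_id by (induction n) (simp_all add: T_comp)
  have T_comm: "\<alpha> \<circ> \<beta> = \<beta> \<circ> \<alpha>" if "\<alpha> \<in> T" "\<beta> \<in> T" for \<alpha> \<beta>
  proof (rule dual_automorphism_inject[OF sep])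
    show "dual_automorphism (\<alpha> \<circ> \<beta>) = dual_automorphism (\<beta> \<circ> \<alpha>)"
      using comm_monoid.m_comm[OF comm_group.axioms(1)[OF comm], of "dual_automorphism \<alpha>" "dual_automorphism \<beta>"]
        T[OF that(1)] T[OF that(2)] by (simp add: mult_dual_linear)
  qed (use T that in \<open>auto intro: linear_automorphism_comp\<close>)
  obtain S where S: "finite S" "S \<subseteq> carrier dual_linear_automorphism_group"
    "\<Gamma> = generate dual_linear_automorphism_group S"
    using fg by (auto simp: finitely_generated_subgroup_def)
  then obtain R where R: "R \<subseteq> linear_automorphisms" "finite R" "S = dual_automorphism ` R"
    by (metis carrier_dual_linear finite_subset_image)
  have RT: "R \<subseteq> T"
    using R generate.incl[of _ S dual_linear_automorphism_group] by (auto simp: T_def S(3))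
  \<comment> \<open>Each new generator r turns \<alpha> into \<open>\<alpha> ^^ m \<circ> r\<close>.
    The space of quasi-periodic vectors can only shrink, so what was achieved for earlier generators
    persists.\<close>
  have "\<exists>\<alpha>\<in>T. \<forall>r\<in>R'. quasi_periodic \<alpha> \<subseteq> quasi_periodic r" if "finite R'" "R' \<subseteq> T" for R'
    using that
  proof (induction R' rule: finite_induct)
    case empty
    then show ?case using T_id by auto
  next
    case (insert r R')
    then obtain \<alpha> where \<alpha>: "\<alpha> \<in> T" "\<forall>r\<in>R'. quasi_periodic \<alpha> \<subseteq> quasi_periodic r" by auto
    have r: "r \<in> T" using insert by auto
    obtain m where m: "quasi_periodic (\<alpha> ^^ m \<circ> r) \<subseteq> quasi_periodic \<alpha> \<inter> quasi_periodic r"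
      using ex_quasi_periodic_subset[OF T(1)[OF \<alpha>(1)] T(1)[OF r] T_comm[OF \<alpha>(1) r]] by auto
    then show ?case
      using \<alpha> by (intro bexI[of _ "\<alpha> ^^ m \<circ> r"] T_comp T_pow r) blast+
  qed
  from this[OF R(2) RT] obtain \<alpha> where \<alpha>: "\<alpha> \<in> T" "\<forall>r\<in>R. quasi_periodic \<alpha> \<subseteq> quasi_periodic r"
    by auto
  have no_common: "v = 0" if v: "\<And>r. r \<in> R \<Longrightarrow> v \<in> quasi_periodic r" for v
  proof (rule ccontr)
    assume "v \<noteq> 0"
    have comm_R: "r \<circ> s = s \<circ> r" if "r \<in> R" "s \<in> R" for r s
      using that RT by (auto intro: T_comm)
    have "\<exists>w. w \<noteq> 0 \<and> (\<forall>r\<in>R. w \<in> quasi_periodic r) \<and> (\<forall>r\<in>R. \<exists>k>0. (r ^^ k) w = w)"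
      using R(1) linear_automorphism_additive
      by (intro ex_common_periodic[OF _ comm_R \<open>v \<noteq> 0\<close> v R(2) order_refl]) auto
    then obtain w where w: "w \<noteq> 0" "\<forall>r\<in>R. \<exists>k>0. (r ^^ k) w = w" by auto
    then obtain k where k: "\<And>r. r \<in> R \<Longrightarrow> k r > 0 \<and> (r ^^ k r) w = w"
      by metis
    obtain Z where Z: "finite Z" "w \<in> Z" "\<forall>r\<in>R. r ` Z \<subseteq> Z"
      using ex_finite_invariant[OF comm_R k R(2) order_refl] by auto
    \<comment> \<open>On a finite set an injective self-map is onto, which upgrades inclusion to the
      equality needed for inverses.\<close>
    have RX: "r ` Z = Z" if "r \<in> R" for r
    proof (rule endo_inj_surj[OF Z(1)])
      show "inj_on r Z"
        using that R(1) linear_automorphism_bij by (blast intro: inj_on_subset dest: bij_is_inj)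
    qed (use Z that in auto)
    have "prob {\<xi> \<in> characters. \<forall>b\<in>Z. cmod (\<xi> b - 1) < e} \<in> {0, 1}" if "e > 0" for e
    proof -
      let ?N = "{\<xi> \<in> characters. \<forall>b\<in>Z. cmod (\<xi> b - 1) < e}"
      have "invariant_under \<Gamma> ?N"
        unfolding invariant_under_def
      proof
        fix \<gamma> assume "\<gamma> \<in> \<Gamma>"
        then obtain \<beta> where "\<beta> \<in> linear_automorphisms" "\<gamma> = dual_automorphism \<beta>" "\<beta> ` Z = Z"
          using generate_dual_invariant[OF sep R(1) RX] S(3) R(3) by blast
        then show "\<gamma> ` ?N = ?N" by (simp only: dual_automorphism_image_neighbourhood)
      qed
      moreover have "?N \<in> sets \<omega>"
        by (intro open_in_sets openin_neighbourhood_one Z(1))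
      ultimately have "emeasure \<omega> ?N \<in> {0, 1}"
        using ergodic by (auto simp: ergodic_group_def)
      then show ?thesis by (simp add: emeasure_eq_measure)
    qed
    then have "\<psi> w = 1" if "\<psi> \<in> characters" for \<psi>
      by (rule annihilated_if_zero_one_neighbourhoods[OF Z(1,2) _ that])
    then show False using sep[OF w(1)] by auto
  qed
  have "(\<alpha> ^^ k) a \<noteq> a" if "a \<noteq> 0" "k > 0" for a k
  proof
    assume "(\<alpha> ^^ k) a = a"
    then have "(\<alpha> ^^ k) a - a \<in> quasi_periodic \<alpha>"
      by (simp add: quasi_periodic.zero)
    then have "a \<in> quasi_periodic \<alpha>"
      by (rule quasi_periodic.step[OF that(2)])
    then show False using no_common[of a] \<alpha>(2) that(1) by auto
  qed
  then have "ergodic_automorphism dual_group \<omega> (dual_automorphism \<alpha>)"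
    by (intro ergodic_automorphism_dual[OF haar sep] T(1)[OF \<alpha>(1)])
  then show ?thesis using T(2)[OF \<alpha>(1)] by blast
qed

theorem theorem5p1:
  assumes "countable (UNIV :: 'f :: field set)"
  shows "has_DCC (dual_group :: ('f ^ 'n \<Rightarrow> complex) monoid) dual_topology
           (group_center dual_linear_automorphism_group)
    \<and> (\<forall>(\<omega> :: ('f ^ 'n \<Rightarrow> complex) measure) \<Gamma>.
         normalized_haar_measure dual_group dual_topology \<omega> \<longrightarrow>
         subgroup \<Gamma> dual_linear_automorphism_group \<longrightarrow>
         comm_group (dual_linear_automorphism_group\<lparr>carrier := \<Gamma>\<rparr>) \<longrightarrow>
         finitely_generated_subgroup \<Gamma> dual_linear_automorphism_group \<longrightarrow>
         ergodic_group \<omega> \<Gamma> \<longrightarrow>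
         (\<exists>\<alpha> \<in> \<Gamma>. ergodic_automorphism dual_group \<omega> \<alpha>))"
proof (intro conjI allI impI)
  show "has_DCC (dual_group :: ('f ^ 'n \<Rightarrow> complex) monoid) dual_topology
      (group_center dual_linear_automorphism_group)"
    by (rule has_DCC_center)
qed (rule ex_ergodic_automorphism)

end
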